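(* (a) Let $M$ be a solvable matroid of rank three. Then $\Gamma_M$ is irreducible. (b) Let $M$ be a paving matroid in which any three (distinct) dependent hyperplanes have an empty intersection. Then $M$ is solvable, and $\Gamma_M$ is irreducible.
   Context: Matroids have ground set $[n]=\{1,\dots,n\}$; elements are called points. Subspaces. For a matroid $M$ of rank $r$, two circuits $C_1,C_2$ of size less than $r+1$ are equivalent if they have the same closure. The equivalence classes are called the subspaces of $M$; $\mathfrak{S}_M$ is the set of subspaces. $\operatorname{rk}(l)$ is the common rank of the circuits in $l\in\mathfrak{S}_M$. A point $p$ belongs to $l$ if $p\in C$ for some circuit $C\in l$; $l$ is identified with its set of points. $\mathfrak{S}_p$ is the set of subspaces containing $p$. A subset $N$ of the ground set is identified with the submatroid $M|N$ (restriction), whose rank and subspaces are those of $M|N$ as a matroid in its own right. Solvable. For a point $p$ of $M$ put $a_p=\sum_{l\in\mathfrak{S}_p}\operatorname{rk}(l)-r(|\mathfrak{S}_p|-1)$ and $Q_M=\{p\in[n]:a_p\le0\}$. The solvable chain of $M$ is $M^0=M$, $M^1=Q_M$, $M^{j+1}=Q_{M^j}$ for $j\ge1$ (for a submatroid $N$, the set $Q_N$ is computed with the rank and subspaces of $N$). $M$ is solvable if $M^j=\emptyset$ for some $j$. Paving. A matroid of rank $r$ is paving if every circuit has size $r$ or $r+1$. In this case the subspaces are the dependent hyperplanes of $M$: the maximal subsets of points of size at least $r$ in which every subset of $r$ elements is a circuit. All rank-three matroids are assumed simple. $\Gamma_M\subset\mathbb{C}^{rn}$ is the realization space: the set of families $(\gamma_1,\dots,\gamma_n)$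 of vectors of $\mathbb{C}^r$ ($r$ the rank of $M$) such that the subfamily indexed by $A$ is linearly dependent if and only if $A$ is dependent in $M$. Irreducibility is in the Zariski topology, and the empty set is regarded as irreducible (so realizability is not claimed in (a)).
   Formalization: In (b), "M is solvable" is stated only for M without loops: a loop p always has a_p = 0 and is never removed, so a paving matroid of rank 0 or 1 with a loop is not solvable; irreducibility in (b) is proved without this restriction. *)

theory Defs
  imports "HOL-Analysis.Analysis"
begin

section \<open>Matroids\<close>

record 'a set_system =
  ground :: "'a set"
  indep :: "'a set \<Rightarrow> bool"

locale matroid =
  fixes M :: "'a set_system"
  assumes finite_ground: "finite (ground M)"
    and indep_subset_ground: "indep M X \<Longrightarrow> X \<subseteq> ground M"
    and indep_empty: "indep M {}"
    and indep_subset: "indep M X \<Longrightarrow> Y \<subseteq> X \<Longrightarrow> indep M Y"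
    and indep_augment:
      "indep M X \<Longrightarrow> indep M Y \<Longrightarrow> card Y < card X \<Longrightarrow> \<exists>x\<in>X - Y. indep M (insert x Y)"

definition restriction :: "'a set_system \<Rightarrow> 'a set \<Rightarrow> 'a set_system" where
  "restriction M N = \<lparr>ground = ground M \<inter> N, indep = (\<lambda>X. indep M X \<and> X \<subseteq> N)\<rparr>"

definition circuits :: "'a set_system \<Rightarrow> 'a set set" where
  "circuits M = {C. C \<subseteq> ground M \<and> \<not> indep M C \<and> (\<forall>D. D \<subset> C \<longrightarrow> indep M D)}"

definition set_rank :: "'a set_system \<Rightarrow> 'a set \<Rightarrow> nat" where
  "set_rank M X = Max (card ` {Y. Y \<subseteq> X \<and> indep M Y})"

definition matroid_rank :: "'a set_system \<Rightarrow> nat" where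
  "matroid_rank M = set_rank M (ground M)"

definition matroid_closure :: "'a set_system \<Rightarrow> 'a set \<Rightarrow> 'a set" where
  "matroid_closure M X = {x \<in> ground M. set_rank M (insert x X) = set_rank M X}"

definition loopless :: "'a set_system \<Rightarrow> bool" where
  "loopless M \<longleftrightarrow> (\<forall>p\<in>ground M. indep M {p})"

definition simple_matroid :: "'a set_system \<Rightarrow> bool" where
  "simple_matroid M \<longleftrightarrow> (\<forall>C\<in>circuits M. 2 < card C)"

definition paving :: "'a set_system \<Rightarrow> bool" where
  "paving M \<longleftrightarrow> (\<forall>C\<in>circuits M. card C = matroid_rank M \<or> card C = matroid_rank M + 1)"

definition uniformly_dependent :: "'a set_system \<Rightarrow> 'a set \<Rightarrow> bool" where
  "uniformly_dependent M H \<longleftrightarrow>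
     H \<subseteq> ground M \<and> matroid_rank M \<le> card H \<and>
     (\<forall>C. C \<subseteq> H \<and> card C = matroid_rank M \<longrightarrow> C \<in> circuits M)"

definition dependent_hyperplanes :: "'a set_system \<Rightarrow> 'a set set" where
  "dependent_hyperplanes M =
     {H. uniformly_dependent M H \<and> (\<forall>H'. uniformly_dependent M H' \<and> H \<subseteq> H' \<longrightarrow> H' = H)}"


section \<open>Subspaces and solvability\<close>

text \<open>A subspace is literally an equivalence class of circuits; its set of points is the union
  of that class. A loop \<open>p\<close> has \<open>point_excess M p = 0\<close>, so loops survive in every step of the
  chain and a matroid with a loop is never solvable.\<close>

definition small_circuits :: "'a set_system \<Rightarrow> 'a set set" where
  "small_circuits M = {C \<in> circuits M. card C < matroid_rank M + 1}"

definition same_closure :: "'a set_system \<Rightarrow> ('a set \<times> 'a set) set" where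
  "same_closure M = {(C1, C2). C1 \<in> small_circuits M \<and> C2 \<in> small_circuits M \<and>
     matroid_closure M C1 = matroid_closure M C2}"

definition matroid_subspaces :: "'a set_system \<Rightarrow> 'a set set set" where
  "matroid_subspaces M = small_circuits M // same_closure M"

definition subspace_rank :: "'a set_system \<Rightarrow> 'a set set \<Rightarrow> nat" where
  "subspace_rank M l = (THE k. \<forall>C\<in>l. set_rank M C = k)"

definition subspaces_at :: "'a set_system \<Rightarrow> 'a \<Rightarrow> 'a set set set" where
  "subspaces_at M p = {l \<in> matroid_subspaces M. p \<in> \<Union> l}"

definition point_excess :: "'a set_system \<Rightarrow> 'a \<Rightarrow> int" where
  "point_excess M p =
     (\<Sum>l\<in>subspaces_at M p. int (subspace_rank M l))
       - int (matroid_rank M) * (int (card (subspaces_at M p)) - 1)"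

definition Q_set :: "'a set_system \<Rightarrow> 'a set" where
  "Q_set M = {p \<in> ground M. point_excess M p \<le> 0}"

primrec solvable_chain :: "'a set_system \<Rightarrow> nat \<Rightarrow> 'a set_system" where
  "solvable_chain M 0 = M"
| "solvable_chain M (Suc j) = restriction M (Q_set (solvable_chain M j))"

definition solvable :: "'a set_system \<Rightarrow> bool" where
  "solvable M \<longleftrightarrow> (\<exists>j. ground (solvable_chain M j) = {})"


section \<open>Zariski topology on complex affine space\<close>

text \<open>The affine space with coordinates indexed by \<open>I\<close>. A point is a function on the index type
  which is \<open>undefined\<close> outside \<open>I\<close>.\<close>

definition affine_space :: "'i set \<Rightarrow> ('i \<Rightarrow> complex) set" where
  "affine_space I = I \<rightarrow>\<^sub>E UNIV"

inductive_set poly_funs :: "'i set \<Rightarrow> (('i \<Rightarrow> complex) \<Rightarrow> complex) set" for I where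
  const: "(\<lambda>x. c) \<in> poly_funs I"
| coord: "i \<in> I \<Longrightarrow> (\<lambda>x. x i) \<in> poly_funs I"
| add: "f \<in> poly_funs I \<Longrightarrow> g \<in> poly_funs I \<Longrightarrow> (\<lambda>x. f x + g x) \<in> poly_funs I"
| mult: "f \<in> poly_funs I \<Longrightarrow> g \<in> poly_funs I \<Longrightarrow> (\<lambda>x. f x * g x) \<in> poly_funs I"

definition zero_locus :: "'i set \<Rightarrow> (('i \<Rightarrow> complex) \<Rightarrow> complex) set \<Rightarrow> ('i \<Rightarrow> complex) set" where
  "zero_locus I S = {x \<in> affine_space I. \<forall>f\<in>S. f x = 0}"

definition zariski :: "'i set \<Rightarrow> ('i \<Rightarrow> complex) topology" where
  "zariski I = topology (\<lambda>U. \<exists>S\<subseteq>poly_funs I. U = affine_space I - zero_locus I S)"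

lemma istopology_zariski:
  "istopology (\<lambda>U. \<exists>S\<subseteq>poly_funs I. U = affine_space I - zero_locus I S)"
  unfolding istopology_def
proof (intro conjI allI impI)
  fix U V
  assume "\<exists>S\<subseteq>poly_funs I. U = affine_space I - zero_locus I S"
    and "\<exists>S\<subseteq>poly_funs I. V = affine_space I - zero_locus I S"
  then obtain S T where S: "S \<subseteq> poly_funs I" "U = affine_space I - zero_locus I S"
    and T: "T \<subseteq> poly_funs I" "V = affine_space I - zero_locus I T"
    by blast
  define P where "P = (\<lambda>(f, g) x. f x * g x) ` (S \<times> T)"
  have "P \<subseteq> poly_funs I"
    using S(1) T(1) by (auto simp: P_def intro: poly_funs.mult)
  moreover have "U \<inter> V = affine_space I - zero_locus I P"
    by (auto simp: S(2) T(2) P_def zero_locus_def)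
  ultimately show "\<exists>S\<subseteq>poly_funs I. U \<inter> V = affine_space I - zero_locus I S"
    by blast
next
  fix K
  assume "\<forall>U\<in>K. \<exists>S\<subseteq>poly_funs I. U = affine_space I - zero_locus I S"
  then obtain F where F: "\<And>U. U \<in> K \<Longrightarrow> F U \<subseteq> poly_funs I \<and> U = affine_space I - zero_locus I (F U)"
    by metis
  have "\<Union> K = affine_space I - zero_locus I (\<Union>U\<in>K. F U)"
  proof -
    have "\<Union> K = (\<Union>U\<in>K. affine_space I - zero_locus I (F U))"
      using F by auto
    then show ?thesis
      by (auto simp: zero_locus_def)
  qed
  moreover have "(\<Union>U\<in>K. F U) \<subseteq> poly_funs I"
    using F by blast
  ultimately show "\<exists>S\<subseteq>poly_funs I. \<Union> K = affine_space I - zero_locus I S"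
    by blast
qed

lemma openin_zariski:
  "openin (zariski I) U \<longleftrightarrow> (\<exists>S\<subseteq>poly_funs I. U = affine_space I - zero_locus I S)"
  by (simp add: zariski_def topology_inverse'[OF istopology_zariski])

lemma topspace_zariski: "topspace (zariski I) = affine_space I"
proof -
  have "zero_locus I {\<lambda>x. 1} = {}"
    by (simp add: zero_locus_def)
  then have "openin (zariski I) (affine_space I)"
    unfolding openin_zariski by (intro exI[of _ "{\<lambda>x. 1}"]) (simp add: poly_funs.const)
  moreover have "U \<subseteq> affine_space I" if "openin (zariski I) U" for U
    using that by (auto simp: openin_zariski)
  ultimately show ?thesis
    by (simp add: topspace_def) blast
qed

lemma closedin_zariski:
  "closedin (zariski I) Z \<longleftrightarrow> (\<exists>S\<subseteq>poly_funs I. Z = zero_locus I S)"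
proof -
  have "zero_locus I S \<subseteq> affine_space I" for S
    by (auto simp: zero_locus_def)
  then show ?thesis
    unfolding closedin_def topspace_zariski openin_zariski
    by (metis Diff_Diff_Int Diff_subset inf.absorb_iff2)
qed

text \<open>The empty space counts as irreducible.\<close>

definition irreducible_space :: "'b topology \<Rightarrow> bool" where
  "irreducible_space X \<longleftrightarrow>
     (\<forall>C D. closedin X C \<and> closedin X D \<and> C \<union> D = topspace X \<longrightarrow>
        C = topspace X \<or> D = topspace X)"

definition zariski_irreducible :: "'i set \<Rightarrow> ('i \<Rightarrow> complex) set \<Rightarrow> bool" where
  "zariski_irreducible I S \<longleftrightarrow> irreducible_space (subtopology (zariski I) S)"


section \<open>Realization spaces\<close>

text \<open>A family of vectors \<open>(\<gamma>\<^sub>i)\<close> in complex \<open>r\<close>-space is encoded by its coordinates: \<open>\<gamma> (i, k)\<close> is the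
  \<open>k\<close>-th coordinate of the \<open>i\<close>-th vector. Dependence is that of a family, not of the set of its
  values, so repeated vectors are dependent.\<close>

definition dependent_subfamily :: "nat \<Rightarrow> ('a \<times> nat \<Rightarrow> complex) \<Rightarrow> 'a set \<Rightarrow> bool" where
  "dependent_subfamily r \<gamma> A \<longleftrightarrow>
     (\<exists>c. (\<exists>i\<in>A. c i \<noteq> 0) \<and> (\<forall>k\<in>{1..r}. (\<Sum>i\<in>A. c i * \<gamma> (i, k)) = 0))"

definition coordinate_indices :: "'a set_system \<Rightarrow> ('a \<times> nat) set" where
  "coordinate_indices M = ground M \<times> {1..matroid_rank M}"

definition realization_space :: "'a set_system \<Rightarrow> ('a \<times> nat \<Rightarrow> complex) set" where
  "realization_space M =
     {\<gamma> \<in> affine_space (coordinate_indices M).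
        \<forall>A\<subseteq>ground M. dependent_subfamily (matroid_rank M) \<gamma> A \<longleftrightarrow> \<not> indep M A}"

end

theory Submission
  imports Defs "HOL-Computational_Algebra.Polynomial"
begin

text \<open>Both parts concern paving matroids, since a simple matroid of rank three is paving. For a paving
  matroid of rank \<open>r\<close> the subspaces are the dependent hyperplanes, each of rank \<open>r - 1\<close>, so that
  \<open>a\<^sub>p = r - k\<close> when \<open>k\<close> dependent hyperplanes contain \<open>p\<close> (\<open>point_excess_eq\<close>). In the
  second part \<open>k \<le> 2\<close>, and without loops even \<open>k < r\<close>, also in rank one and two; so \<open>Q\<^sub>M\<close> is empty and
  the solvability claim follows.

  For irreducibility, call a dependent hyperplane \<^emph>\<open>active\<close> at a new point \<open>p\<close> if it contains \<open>p\<close> and at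
  least \<open>r - 1\<close> of the points already present. In both parts the points can be added one at a time
  such that at most two hyperplanes are active at each new point (\<open>buildable\<close>): in the second part in
  any order, in the first part by running the solvable chain backwards. In a realization the vector
  of \<open>p\<close> then lies in the intersection of at most two hyperplanes of \<open>\<complex>\<^sup>r\<close>, and two different dependent
  hyperplanes always span different linear hyperplanes (\<open>normals_independent\<close>). Hence the solution space
  for the new vector has constant dimension over the realization space.

  This structure is exploited without projections or generic parameters, by joining points with
  curves. A set is irreducible if any two of its points \<open>x\<close>, \<open>y\<close> lie on a polynomial curve \<open>c\<close> with
  \<open>c 0 = x\<close> and \<open>c 1 = y\<close> that stays in the set for all but finitely many parameters
  (\<open>zariski_irreducible_if_curves\<close>): otherwise two polynomials \<open>f\<close>, \<open>g\<close> with \<open>f x \<noteq> 0\<close> and \<open>g y \<noteq> 0\<close> would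
  have a product vanishing on the set, although \<open>f \<circ> c\<close> and \<open>g \<circ> c\<close> are nonzero polynomials in one
  variable. Such a curve between two realizations is built point by point (\<open>ex_curve\<close>), together with
  a moving normal vector for each dependent hyperplane. The tool is \<open>kernel_curve\<close>: given linear forms
  that vary polynomially and are independent at the parameters 0 and 1, any two vectors in their
  kernels at 0 and at 1 are joined by a polynomial curve inside the moving kernel. Along the final
  curve, independent sets stay independent for all but finitely many parameters, and dependent sets
  stay dependent as long as the normals do not vanish.\<close>

section \<open>Polynomial curves and irreducibility\<close>

text \<open>Membership in \<open>range poly\<close> says that a function of one complex variable is polynomial.\<close>

lemma poly_fun_const: "(\<lambda>s. c) \<in> range (poly :: complex poly \<Rightarrow> _)"
  by (rule range_eqI[where x = "[:c:]"]) auto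

lemma poly_fun_ident: "(\<lambda>s. s) \<in> range (poly :: complex poly \<Rightarrow> _)"
  by (rule range_eqI[where x = "[:0, 1:]"]) auto

lemma poly_fun_add:
  assumes "f \<in> range (poly :: complex poly \<Rightarrow> _)" "g \<in> range poly"
  shows "(\<lambda>s. f s + g s) \<in> range poly"
proof -
  obtain p q where "f = poly p" "g = poly q" using assms by blast
  then show ?thesis by (intro range_eqI[where x = "p + q"]) auto
qed

lemma poly_fun_mult:
  assumes "f \<in> range (poly :: complex poly \<Rightarrow> _)" "g \<in> range poly"
  shows "(\<lambda>s. f s * g s) \<in> range poly"
proof -
  obtain p q where "f = poly p" "g = poly q" using assms by blast
  then show ?thesis by (intro range_eqI[where x = "p * q"]) auto
qed

lemma poly_fun_diff:
  assumes "f \<in> range (poly :: complex poly \<Rightarrow> _)" "g \<in> range poly"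
  shows "(\<lambda>s. f s - g s) \<in> range poly"
proof -
  obtain p q where "f = poly p" "g = poly q" using assms by blast
  then show ?thesis by (intro range_eqI[where x = "p - q"]) auto
qed

lemma poly_fun_sum:
  assumes "\<And>i. i \<in> A \<Longrightarrow> f i \<in> range (poly :: complex poly \<Rightarrow> _)"
  shows "(\<lambda>s. \<Sum>i\<in>A. f i s) \<in> range poly"
  using assms
proof (induction A rule: infinite_finite_induct)
  case (insert i A)
  then show ?case
    using poly_fun_add[of "f i" "\<lambda>s. \<Sum>i\<in>A. f i s"] by simp
qed (simp_all add: poly_fun_const)

lemmas poly_fun_intros =
  poly_fun_const poly_fun_ident poly_fun_add poly_fun_mult poly_fun_diff poly_fun_sum

lemma finite_zeros_poly_fun:
  assumes "f \<in> range (poly :: complex poly \<Rightarrow> _)" "f s0 \<noteq> 0"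
  shows "finite {s. f s = 0}"
proof -
  obtain p where p: "f = poly p"
    using assms(1) by blast
  then have "p \<noteq> 0"
    using assms(2) by auto
  then show ?thesis
    unfolding p by (rule poly_roots_finite)
qed

lemma poly_fun_comp_poly_funs:
  assumes "f \<in> poly_funs I" "\<And>i. i \<in> I \<Longrightarrow> (\<lambda>s. c s i) \<in> range poly"
  shows "(\<lambda>s. f (c s)) \<in> range poly"
  using assms
proof (induction f rule: poly_funs.induct)
  case (add f g)
  then show ?case by (intro poly_fun_add) auto
next
  case (mult f g)
  then show ?case by (intro poly_fun_mult) auto
qed (simp_all only: poly_fun_const)

lemma zariski_irreducible_if_curves:
  assumes "S \<subseteq> affine_space I"
    and curve: "\<And>x y. x \<in> S \<Longrightarrow> y \<in> S \<Longrightarrow>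
      \<exists>c. (\<forall>i\<in>I. (\<lambda>s. c s i) \<in> range poly) \<and> c 0 = x \<and> c 1 = y \<and> finite {s. c s \<notin> S}"
  shows "zariski_irreducible I S"
  unfolding zariski_irreducible_def irreducible_space_def
proof (intro allI impI, elim conjE)
  fix C D
  have top: "topspace (subtopology (zariski I) S) = S"
    using assms(1) by (auto simp: topspace_zariski)
  assume "closedin (subtopology (zariski I) S) C" "closedin (subtopology (zariski I) S) D"
    and "C \<union> D = topspace (subtopology (zariski I) S)"
  then obtain F G where F: "F \<subseteq> poly_funs I" "C = zero_locus I F \<inter> S"
    and G: "G \<subseteq> poly_funs I" "D = zero_locus I G \<inter> S" and un: "C \<union> D = S"
    unfolding closedin_subtopology closedin_zariski top by blast
  show "C = topspace (subtopology (zariski I) S) \<or> D = topspace (subtopology (zariski I) S)"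
  proof (rule ccontr)
    assume "\<not> ?thesis"
    then obtain x y where x: "x \<in> S" "x \<notin> C" and y: "y \<in> S" "y \<notin> D"
      using un unfolding top by blast
    obtain f where f: "f \<in> F" "f x \<noteq> 0"
      using x F(2) assms(1) by (auto simp: zero_locus_def)
    obtain g where g: "g \<in> G" "g y \<noteq> 0"
      using y G(2) assms(1) by (auto simp: zero_locus_def)
    obtain c where c: "\<And>i. i \<in> I \<Longrightarrow> (\<lambda>s. c s i) \<in> range poly" "c 0 = x" "c 1 = y"
      "finite {s. c s \<notin> S}"
      using curve[OF x(1) y(1)] by blast
    have "finite {s. f (c s) = 0}"
      using finite_zeros_poly_fun[of "\<lambda>s. f (c s)" 0] poly_fun_comp_poly_funs[of f I c] f F(1) c
      by auto
    moreover have "finite {s. g (c s) = 0}"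
      using finite_zeros_poly_fun[of "\<lambda>s. g (c s)" 1] poly_fun_comp_poly_funs[of g I c] g G(1) c
      by auto
    moreover have "UNIV \<subseteq> {s. c s \<notin> S} \<union> {s. f (c s) = 0} \<union> {s. g (c s) = 0}"
      using un F(2) G(2) f(1) g(1) by (auto simp: zero_locus_def)
    ultimately have "finite (UNIV :: complex set)"
      using c(4) by (meson finite_Un finite_subset)
    then show False
      using infinite_UNIV_char_0 by blast
  qed
qed


section \<open>Linear dependence of families of vectors\<close>

text \<open>Linear dependence of the family \<open>(v i)\<close>, \<open>i \<in> A\<close>, of vectors with coordinates indexed by \<open>K\<close>.\<close>

definition lin_dep :: "'k set \<Rightarrow> ('i \<Rightarrow> 'k \<Rightarrow> complex) \<Rightarrow> 'i set \<Rightarrow> bool" where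
  "lin_dep K v A \<longleftrightarrow>
     (\<exists>c. (\<exists>i\<in>A. c i \<noteq> 0) \<and> (\<forall>k\<in>K. (\<Sum>i\<in>A. c i * v i k) = 0))"

text \<open>The bilinear (not sesquilinear) pairing, as vectors serve both as points and as linear forms.\<close>

definition dot :: "'k set \<Rightarrow> ('k \<Rightarrow> complex) \<Rightarrow> ('k \<Rightarrow> complex) \<Rightarrow> complex" where
  "dot K x y = (\<Sum>k\<in>K. x k * y k)"

lemma dependent_subfamily_iff_lin_dep:
  "dependent_subfamily r \<gamma> A \<longleftrightarrow> lin_dep {1..r} (curry \<gamma>) A"
  by (simp add: dependent_subfamily_def lin_dep_def)

lemma lin_dep_mono:
  assumes "lin_dep K v A" "A \<subseteq> B" "finite B"
  shows "lin_dep K v B"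
proof -
  obtain c where c: "\<exists>i\<in>A. c i \<noteq> 0" "\<forall>k\<in>K. (\<Sum>i\<in>A. c i * v i k) = 0"
    using assms(1) by (auto simp: lin_dep_def)
  have "(\<Sum>i\<in>B. (if i \<in> A then c i else 0) * v i k) = (\<Sum>i\<in>A. c i * v i k)" for k
    using assms(2,3) by (intro sum.mono_neutral_cong_right) auto
  then show ?thesis
    using c assms(2) unfolding lin_dep_def
    by (intro exI[of _ "\<lambda>i. if i \<in> A then c i else 0"]) auto
qed

text \<open>Elimination: subtracting multiples of \<open>v j\<close> from a nonzero multiple of the other vectors preserves
  independence. The converse holds when the multipliers are the coordinates at a pivot position.\<close>

lemma lin_dep_eliminateD:
  assumes "finite A" "j \<notin> A" "c \<noteq> 0"
    and dep: "lin_dep K (\<lambda>i k. c * v i k - d i * v j k) A"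
  shows "lin_dep K v (insert j A)"
proof -
  obtain e where e: "\<exists>i\<in>A. e i \<noteq> 0"
    "\<And>k. k \<in> K \<Longrightarrow> (\<Sum>i\<in>A. e i * (c * v i k - d i * v j k)) = 0"
    using dep by (auto simp: lin_dep_def)
  define e' where "e' = (\<lambda>i. if i = j then - (\<Sum>i\<in>A. e i * d i) else e i * c)"
  have "(\<Sum>i\<in>insert j A. e' i * v i k) = 0" if "k \<in> K" for k
  proof -
    have "(\<Sum>i\<in>insert j A. e' i * v i k)
        = - (\<Sum>i\<in>A. e i * d i) * v j k + (\<Sum>i\<in>A. e' i * v i k)"
      using assms by (simp add: e'_def)
    also have "(\<Sum>i\<in>A. e' i * v i k) = (\<Sum>i\<in>A. e i * c * v i k)"
      using assms(2) by (intro sum.cong) (auto simp: e'_def)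
    also have "- (\<Sum>i\<in>A. e i * d i) * v j k + (\<Sum>i\<in>A. e i * c * v i k)
        = (\<Sum>i\<in>A. e i * (c * v i k - d i * v j k))"
      by (simp add: sum_distrib_left sum_distrib_right sum_subtractf algebra_simps)
    finally show ?thesis
      using e(2)[OF that] by simp
  qed
  moreover have "\<exists>i\<in>insert j A. e' i \<noteq> 0"
    using e(1) assms(2,3) by (auto simp: e'_def)
  ultimately show ?thesis
    unfolding lin_dep_def by blast
qed

lemma lin_dep_pivot:
  assumes "finite A" "j \<notin> A" "m \<in> K" "v j m \<noteq> 0"
    and dep: "lin_dep K v (insert j A)"
  shows "lin_dep K (\<lambda>i k. v j m * v i k - v i m * v j k) A"
proof -
  obtain e where e: "\<exists>i\<in>insert j A. e i \<noteq> 0"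
    "\<And>k. k \<in> K \<Longrightarrow> (\<Sum>i\<in>insert j A. e i * v i k) = 0"
    using dep by (auto simp: lin_dep_def)
  have eq: "(\<Sum>i\<in>A. e i * v i k) = - e j * v j k" if "k \<in> K" for k
    using e(2)[OF that] assms(1,2) by (simp add: add_eq_0_iff)
  have "(\<Sum>i\<in>A. e i * (v j m * v i k - v i m * v j k)) = 0" if "k \<in> K" for k
  proof -
    have "(\<Sum>i\<in>A. e i * (v j m * v i k - v i m * v j k))
        = v j m * (\<Sum>i\<in>A. e i * v i k) - (\<Sum>i\<in>A. e i * v i m) * v j k"
      by (simp add: sum_distrib_left sum_distrib_right sum_subtractf algebra_simps)
    then show ?thesis
      using eq[OF that] eq[OF assms(3)] by simp
  qed
  moreover have "\<exists>i\<in>A. e i \<noteq> 0"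
  proof (rule ccontr)
    assume none: "\<not> ?thesis"
    then have "(\<Sum>i\<in>A. e i * v i m) = 0"
      by simp
    then have "e j = 0"
      using eq[OF assms(3)] assms(4) by simp
    then show False
      using e(1) none by auto
  qed
  ultimately show ?thesis
    unfolding lin_dep_def by blast
qed

lemma lin_dep_zero_vector:
  assumes "finite A" "j \<in> A" "\<And>k. k \<in> K \<Longrightarrow> v j k = 0"
  shows "lin_dep K v A"
proof -
  have "(\<Sum>i\<in>A. (if i = j then 1 else 0) * v i k) = 0" if "k \<in> K" for k
    using assms that by (intro sum.neutral) auto
  then show ?thesis
    using assms(2) unfolding lin_dep_def
    by (intro exI[of _ "\<lambda>i. if i = j then 1 else 0"]) auto
qed

lemma lin_dep_if_card_less:
  assumes "finite K" "finite A" "card K < card A"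
  shows "lin_dep K v A"
  using assms
proof (induction K arbitrary: A v rule: finite_induct)
  case empty
  then obtain i where "i \<in> A" by fastforce
  then show ?case by (auto simp: lin_dep_def intro!: exI[of _ "\<lambda>_. 1"])
next
  case (insert k K)
  show ?case
  proof (cases "\<forall>i\<in>A. v i k = 0")
    case True
    have "lin_dep K v A"
      using insert by (intro insert.IH) auto
    then show ?thesis
      using True by (auto simp: lin_dep_def)
  next
    case False
    then obtain j where j: "j \<in> A" "v j k \<noteq> 0" by blast
    let ?v = "\<lambda>i k'. v j k * v i k' - v i k * v j k'"
    have "lin_dep K ?v (A - {j})"
      using insert j by (intro insert.IH) auto
    then have "lin_dep (insert k K) ?v (A - {j})"
      by (auto simp: lin_dep_def)
    then have "lin_dep (insert k K) v (insert j (A - {j}))"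
      using insert.prems j(2) by (intro lin_dep_eliminateD[where c = "v j k" and d = "\<lambda>i. v i k"]) auto
    then show ?thesis
      using j(1) by (simp add: insert_absorb)
  qed
qed

text \<open>As many vectors as the dimension of the space are dependent if they lie in one linear hyperplane.
  The equation at the coordinate \<open>m\<close>, where the normal does not vanish, follows from all others.\<close>

lemma lin_dep_if_common_normal:
  assumes "finite K" "finite A" "card A = card K" "m \<in> K" "n m \<noteq> 0"
    and normal: "\<And>i. i \<in> A \<Longrightarrow> dot K n (v i) = 0"
  shows "lin_dep K v A"
proof -
  have "card (K - {m}) < card A"
    using assms by (metis card_Diff1_less)
  then obtain c where c: "\<exists>i\<in>A. c i \<noteq> 0" "\<And>k. k \<in> K - {m} \<Longrightarrow> (\<Sum>i\<in>A. c i * v i k) = 0"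
    using lin_dep_if_card_less[of "K - {m}" A v] assms(1,2) unfolding lin_dep_def by blast
  have "0 = (\<Sum>i\<in>A. c i * dot K n (v i))"
    using normal by simp
  also have "\<dots> = (\<Sum>k\<in>K. n k * (\<Sum>i\<in>A. c i * v i k))"
    unfolding dot_def sum_distrib_left
    by (subst sum.swap) (simp add: mult.left_commute)
  also have "\<dots> = n m * (\<Sum>i\<in>A. c i * v i m)"
    using c(2) assms(1,4) by (subst sum.remove[where x = m]) (auto intro!: sum.neutral)
  finally have "(\<Sum>i\<in>A. c i * v i m) = 0"
    using assms(5) by simp
  then show ?thesis
    using c unfolding lin_dep_def by blast
qed

text \<open>The matrix of the family is transposed: the unknowns are the coordinates of the normal.\<close>

lemma ex_common_normal:
  assumes "finite K" "finite A" "card A < card K"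
  shows "\<exists>n. (\<exists>k\<in>K. n k \<noteq> 0) \<and> (\<forall>i\<in>A. dot K n (v i) = 0)"
  using lin_dep_if_card_less[of A K "\<lambda>k i. v i k"] assms unfolding lin_dep_def dot_def by blast

lemma normal_insert:
  assumes "finite A" "q \<notin> A" "\<not> lin_dep K v A" "lin_dep K v (insert q A)"
    and normal: "\<And>i. i \<in> A \<Longrightarrow> dot K n (v i) = 0"
  shows "dot K n (v q) = 0"
proof -
  obtain c where c: "\<exists>i\<in>insert q A. c i \<noteq> 0"
    "\<And>k. k \<in> K \<Longrightarrow> (\<Sum>i\<in>insert q A. c i * v i k) = 0"
    using assms(4) unfolding lin_dep_def by blast
  have "c q \<noteq> 0"
  proof
    assume "c q = 0"
    then have "lin_dep K v A"
      using c assms(1,2) unfolding lin_dep_def by auto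
    then show False using assms(3) by blast
  qed
  have "(\<Sum>i\<in>insert q A. c i * dot K n (v i)) = (\<Sum>k\<in>K. n k * (\<Sum>i\<in>insert q A. c i * v i k))"
    unfolding dot_def sum_distrib_left
    by (subst sum.swap) (simp add: mult.left_commute)
  also have "\<dots> = 0"
    using c(2) by simp
  finally show ?thesis
    using assms(1,2) normal \<open>c q \<noteq> 0\<close> by simp
qed

text \<open>Independence is an open condition along a polynomial curve. Gaussian elimination with pivots that
  are nonzero at \<open>s0\<close> works for all but finitely many parameters, so no determinants are needed.\<close>

lemma finite_lin_dep_curve:
  assumes "finite A" "\<And>i k. i \<in> A \<Longrightarrow> k \<in> K \<Longrightarrow> (\<lambda>s. v s i k) \<in> range poly"
    and "\<not> lin_dep K (v s0) A"
  shows "finite {s. lin_dep K (v s) A}"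
  using assms
proof (induction A arbitrary: v rule: finite_induct)
  case empty
  then show ?case by (simp add: lin_dep_def)
next
  case (insert j A)
  obtain m where m: "m \<in> K" "v s0 j m \<noteq> 0"
    using lin_dep_zero_vector[of "insert j A" j K "v s0"] insert by blast
  let ?v = "\<lambda>s i k. v s j m * v s i k - v s i m * v s j k"
  have "finite {s. v s j m = 0}"
    using insert.prems(1)[of j m] m by (intro finite_zeros_poly_fun[where ?s0.0 = s0]) auto
  moreover have "finite {s. lin_dep K (?v s) A}"
  proof (rule insert.IH)
    show "(\<lambda>s. ?v s i k) \<in> range poly" if "i \<in> A" "k \<in> K" for i k
      using that insert.prems(1) m(1) by (intro poly_fun_intros) auto
    show "\<not> lin_dep K (?v s0) A"
      using insert.prems(2) insert.hyps m(2) lin_dep_eliminateD[of A j "v s0 j m" K "v s0" "\<lambda>i. v s0 i m"]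
      by blast
  qed
  moreover have "{s. lin_dep K (v s) (insert j A)} \<subseteq> {s. v s j m = 0} \<union> {s. lin_dep K (?v s) A}"
    using lin_dep_pivot[of A j m K] insert.hyps m(1) by blast
  ultimately show ?case
    by (meson finite_Un finite_subset)
qed

lemma dot_linear:
  "dot K x (\<lambda>k. a * y k - b * z k) = a * dot K x y - b * dot K x z"
  "dot K (\<lambda>k. a * y k - b * z k) x = a * dot K y x - b * dot K z x"
  by (simp_all add: dot_def sum_distrib_left sum_subtractf algebra_simps)

lemma dot_commute: "dot K x y = dot K y x"
  by (simp add: dot_def mult.commute)

lemma ex_dot_eq_one:
  assumes "finite K" "k \<in> K" "x k \<noteq> 0"
  shows "\<exists>a. dot K x a = 1"
proof -
  have "dot K x (\<lambda>l. if l = k then 1 / x k else 0) = (\<Sum>l\<in>K. if l = k then 1 else 0)"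
    unfolding dot_def using assms(3) by (intro sum.cong) auto
  then show ?thesis
    using assms by (intro exI[of _ "\<lambda>l. if l = k then 1 / x k else 0"]) simp
qed

lemma poly_fun_dot:
  assumes "\<And>k. (\<lambda>s. x s k) \<in> range poly" "\<And>k. (\<lambda>s. y s k) \<in> range poly"
  shows "(\<lambda>s. dot K (x s) (y s)) \<in> range poly"
  unfolding dot_def using assms by (intro poly_fun_intros)

text \<open>Interpolation inside a moving kernel. Choose \<open>a s\<close> linear in \<open>s\<close> with \<open>\<langle>v s j, a s\<rangle> = 1\<close> at \<open>s = 0, 1\<close>.
  The map \<open>x \<mapsto> \<langle>v s j, a s\<rangle> x - \<langle>v s j, x\<rangle> a s\<close> has values in the kernel of \<open>v s j\<close>, and it pulls the
  other forms \<open>v s i\<close> back to the forms \<open>w s i\<close>, one fewer in number. At \<open>s = 0, 1\<close> it fixes the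
  kernel of \<open>v s j\<close>, hence the two prescribed end points.\<close>

lemma kernel_curve:
  fixes v :: "complex \<Rightarrow> 'i \<Rightarrow> 'k \<Rightarrow> complex"
  assumes "finite K" "finite A" "\<And>i k. i \<in> A \<Longrightarrow> (\<lambda>s. v s i k) \<in> range poly"
    and "\<not> lin_dep K (v 0) A" "\<not> lin_dep K (v 1) A"
    and "\<And>i. i \<in> A \<Longrightarrow> dot K (v 0 i) x0 = 0" "\<And>i. i \<in> A \<Longrightarrow> dot K (v 1 i) x1 = 0"
  shows "\<exists>x. (\<forall>k. (\<lambda>s. x s k) \<in> range poly) \<and> x 0 = x0 \<and> x 1 = x1 \<and>
    (\<forall>s. \<forall>i\<in>A. dot K (v s i) (x s) = 0)"
  using assms(2-)
proof (induction A arbitrary: v rule: finite_induct)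
  case empty
  show ?case
    by (rule exI[of _ "\<lambda>s k. (1 - s) * x0 k + s * x1 k"]) (auto intro!: poly_fun_intros)
next
  case (insert j A)
  have nz: "\<exists>a. dot K (v s j) a = 1" if indep: "\<not> lin_dep K (v s) (insert j A)" for s
  proof -
    obtain k where "k \<in> K" "v s j k \<noteq> 0"
      using lin_dep_zero_vector[of "insert j A" j K "v s"] insert.hyps(1) indep by blast
    then show ?thesis
      by (rule ex_dot_eq_one[OF assms(1)])
  qed
  obtain a0 a1 where a: "dot K (v 0 j) a0 = 1" "dot K (v 1 j) a1 = 1"
    using nz insert.prems by meson
  define a where "a = (\<lambda>s k. (1 - s) * a0 k + s * a1 k)"
  have a_ends: "a 0 = a0" "a 1 = a1"
    by (auto simp: a_def)
  have a_poly: "(\<lambda>s. a s k) \<in> range poly" for k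
    unfolding a_def by (intro poly_fun_intros)
  define w where "w = (\<lambda>s i k. dot K (v s j) (a s) * v s i k - dot K (v s i) (a s) * v s j k)"
  have w_dot: "dot K (w s i) y
      = dot K (v s j) (a s) * dot K (v s i) y - dot K (v s i) (a s) * dot K (v s j) y" for s i y
    unfolding w_def by (rule dot_linear)
  have w_indep: "\<not> lin_dep K (w s) A"
    if "\<not> lin_dep K (v s) (insert j A)" "dot K (v s j) (a s) = 1" for s
    using that insert.hyps
      lin_dep_eliminateD[of A j "dot K (v s j) (a s)" K "v s" "\<lambda>i. dot K (v s i) (a s)"]
    unfolding w_def by auto
  have "\<exists>x. (\<forall>k. (\<lambda>s. x s k) \<in> range poly) \<and> x 0 = x0 \<and> x 1 = x1 \<and>
    (\<forall>s. \<forall>i\<in>A. dot K (w s i) (x s) = 0)"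
  proof (rule insert.IH)
    show "(\<lambda>s. w s i k) \<in> range poly" if "i \<in> A" for i k
      unfolding w_def using that insert.prems(1) a_poly
      by (intro poly_fun_diff poly_fun_mult poly_fun_dot) auto
  qed (use insert.prems w_indep a a_ends in \<open>auto simp: w_dot\<close>)
  then obtain x where x: "\<And>k. (\<lambda>s. x s k) \<in> range poly" "x 0 = x0" "x 1 = x1"
    "\<And>s i. i \<in> A \<Longrightarrow> dot K (w s i) (x s) = 0"
    by blast
  define y where "y = (\<lambda>s k. dot K (v s j) (a s) * x s k - dot K (v s j) (x s) * a s k)"
  have y_dot: "dot K z (y s)
      = dot K (v s j) (a s) * dot K z (x s) - dot K (v s j) (x s) * dot K z (a s)" for s z
    unfolding y_def by (rule dot_linear)
  have "(\<lambda>s. y s k) \<in> range poly" for k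
    unfolding y_def using insert.prems(1) a_poly x(1)
    by (intro poly_fun_diff poly_fun_mult poly_fun_dot) auto
  moreover have "y 0 = x0" "y 1 = x1"
    using x(2,3) a a_ends insert.prems(4,5) by (auto simp: y_def)
  moreover have "dot K (v s i) (y s) = 0" if "i \<in> insert j A" for s i
    using that x(4)[of i s] by (auto simp: y_dot w_dot mult.commute)
  ultimately show ?case
    by blast
qed


lemma ex_subset_card: "n \<le> Suc (card X) \<Longrightarrow> \<exists>S\<subseteq>X. card S = n - 1"
  using obtain_subset_with_card_n[of "n - 1" X] by (metis diff_Suc_1 diff_le_mono)


section \<open>Dependent hyperplanes of paving matroids\<close>

context matroid
begin

lemma finite_indep_subsets: "finite {Y. Y \<subseteq> X \<and> indep M Y}"
  by (rule finite_subset[of _ "Pow (ground M)"]) (use finite_ground indep_subset_ground in auto)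

lemma card_le_set_rank: "Y \<subseteq> X \<Longrightarrow> indep M Y \<Longrightarrow> card Y \<le> set_rank M X"
  unfolding set_rank_def using finite_indep_subsets by (intro Max_ge) auto

lemma set_rank_attained: "\<exists>Y\<subseteq>X. indep M Y \<and> card Y = set_rank M X"
proof -
  have "set_rank M X \<in> card ` {Y. Y \<subseteq> X \<and> indep M Y}"
    unfolding set_rank_def using finite_indep_subsets indep_empty by (intro Max_in) auto
  then show ?thesis by auto
qed

lemma set_rank_less_iff:
  "set_rank M X < k \<longleftrightarrow> (\<forall>Y\<subseteq>X. indep M Y \<longrightarrow> card Y < k)"
proof
  show "\<forall>Y\<subseteq>X. indep M Y \<longrightarrow> card Y < k" if "set_rank M X < k"
    using that card_le_set_rank le_less_trans by blast
  show "set_rank M X < k" if "\<forall>Y\<subseteq>X. indep M Y \<longrightarrow> card Y < k"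
    using that set_rank_attained[of X] by auto
qed

lemma indep_card_le_rank: "indep M Y \<Longrightarrow> card Y \<le> matroid_rank M"
  unfolding matroid_rank_def by (intro card_le_set_rank indep_subset_ground)

lemma finite_subset_ground: "X \<subseteq> ground M \<Longrightarrow> finite X"
  by (rule finite_subset[OF _ finite_ground])

lemma ex_circuit_subset:
  assumes "A \<subseteq> ground M" "\<not> indep M A"
  shows "\<exists>C\<in>circuits M. C \<subseteq> A"
proof -
  have "finite {C. C \<subseteq> A \<and> \<not> indep M C}"
    using finite_subset_ground[OF assms(1)] by simp
  moreover have "A \<in> {C. C \<subseteq> A \<and> \<not> indep M C}"
    using assms(2) by simp
  ultimately obtain C where C: "C \<in> {C. C \<subseteq> A \<and> \<not> indep M C}"
    "\<forall>D\<in>{C. C \<subseteq> A \<and> \<not> indep M C}. D \<le> C \<longrightarrow> C = D"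
    using finite_has_minimal2 by meson
  have "indep M D" if "D \<subset> C" for D
    using C that by auto
  then have "C \<in> circuits M"
    using C(1) assms(1) by (auto simp: circuits_def)
  then show ?thesis
    using C(1) by blast
qed

lemma card_circuit_le: "C \<in> circuits M \<Longrightarrow> card C \<le> matroid_rank M + 1"
proof -
  assume C: "C \<in> circuits M"
  then have dep: "\<not> indep M C" and sub: "\<And>D. D \<subset> C \<Longrightarrow> indep M D"
    by (simp_all add: circuits_def)
  have "C \<noteq> {}"
    using dep indep_empty by metis
  then obtain x where x: "x \<in> C"
    by blast
  then have "indep M (C - {x})"
    by (intro sub) blast
  then have "card (C - {x}) \<le> matroid_rank M"
    by (rule indep_card_le_rank)
  then show ?thesis
    using x by simp
qed

lemma circuits_restriction:
  assumes "N \<subseteq> ground M"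
  shows "circuits (restriction M N) = {C \<in> circuits M. C \<subseteq> N}"
proof -
  have "C \<in> circuits (restriction M N) \<longleftrightarrow> C \<in> circuits M \<and> C \<subseteq> N" for C
  proof (cases "C \<subseteq> N")
    case True
    then have "indep (restriction M N) D = indep M D" if "D \<subseteq> C" for D
      using that by (auto simp: restriction_def)
    moreover have "C \<subseteq> ground (restriction M N)" "C \<subseteq> ground M"
      using True assms by (auto simp: restriction_def)
    ultimately show ?thesis
      using True by (simp add: circuits_def psubset_eq)
  next
    case False
    then have "\<not> C \<subseteq> ground (restriction M N)"
      by (auto simp: restriction_def)
    then show ?thesis
      using False by (simp add: circuits_def)
  qed
  then show ?thesis by blast
qed

lemma matroid_restriction: "matroid (restriction M N)"
proof
  fix X Y
  show "\<exists>x\<in>X - Y. indep (restriction M N) (insert x Y)"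
    if "indep (restriction M N) X" "indep (restriction M N) Y" "card Y < card X"
    using that indep_augment[of X Y] by (auto simp: restriction_def)
  show "indep (restriction M N) Y" if "indep (restriction M N) X" "Y \<subseteq> X"
    using that indep_subset by (auto simp: restriction_def)
qed (use finite_ground indep_subset_ground indep_empty in \<open>auto simp: restriction_def\<close>)

end

text \<open>The rank \<open>r\<close> is arbitrary. If \<open>r = 0\<close> there are no dependent hyperplanes, and if \<open>r = 1\<close> the only
  possible one is the set of all loops.\<close>

locale paving_matroid = matroid +
  assumes paving: "paving M"
begin

abbreviation r where "r \<equiv> matroid_rank M"

lemma circuit_card: "C \<in> circuits M \<Longrightarrow> r \<le> card C"
  using paving by (auto simp: paving_def)

lemma indep_if_card_less:
  assumes "A \<subseteq> ground M" "card A < r"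
  shows "indep M A"
proof (rule ccontr)
  assume "\<not> indep M A"
  then obtain C where C: "C \<in> circuits M" "C \<subseteq> A"
    using ex_circuit_subset assms(1) by blast
  then have "card C \<le> card A"
    using card_mono finite_subset_ground[OF assms(1)] by blast
  then show False
    using circuit_card[OF C(1)] assms(2) by simp
qed

lemma circuit_iff:
  assumes "A \<subseteq> ground M" "card A = r"
  shows "A \<in> circuits M \<longleftrightarrow> \<not> indep M A"
proof
  assume dep: "\<not> indep M A"
  have "indep M D" if "D \<subset> A" for D
    using that assms psubset_card_mono[of A D] finite_subset_ground[OF assms(1)]
    by (intro indep_if_card_less) auto
  then show "A \<in> circuits M"
    using dep assms(1) by (auto simp: circuits_def)
qed (simp add: circuits_def)

lemma uniformly_dependent_iff:
  "uniformly_dependent M H \<longleftrightarrow>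
     H \<subseteq> ground M \<and> r \<le> card H \<and> (\<forall>C. C \<subseteq> H \<and> card C = r \<longrightarrow> \<not> indep M C)"
  unfolding uniformly_dependent_def using circuit_iff by (meson order_trans)

lemma hyperplaneD:
  assumes "H \<in> dependent_hyperplanes M"
  shows "H \<subseteq> ground M" "r \<le> card H" "\<And>C. C \<subseteq> H \<Longrightarrow> card C = r \<Longrightarrow> \<not> indep M C"
    "finite H" "0 < r"
proof -
  show H: "H \<subseteq> ground M" "r \<le> card H" "\<And>C. C \<subseteq> H \<Longrightarrow> card C = r \<Longrightarrow> \<not> indep M C"
    using assms by (auto simp: dependent_hyperplanes_def uniformly_dependent_iff)
  show "finite H"
    using H(1) finite_subset_ground by blast
  show "0 < r"
    using H(3)[of "{}"] indep_empty by (cases r) auto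
qed

lemma finite_hyperplanes: "finite (dependent_hyperplanes M)"
  by (rule finite_subset[of _ "Pow (ground M)"]) (use finite_ground hyperplaneD(1) in auto)

lemma uniformly_dependent_extend:
  assumes "uniformly_dependent M A"
  shows "\<exists>H\<in>dependent_hyperplanes M. A \<subseteq> H"
proof -
  have "finite {H. uniformly_dependent M H}"
    by (rule finite_subset[of _ "Pow (ground M)"])
      (use finite_ground in \<open>auto simp: uniformly_dependent_def\<close>)
  then show ?thesis
    using finite_has_maximal2[of "{H. uniformly_dependent M H}" A] assms
    by (auto simp: dependent_hyperplanes_def)
qed

lemma hyperplane_eq_if_union:
  assumes "H1 \<in> dependent_hyperplanes M" "H2 \<in> dependent_hyperplanes M"
    and "\<And>C. C \<subseteq> H1 \<union> H2 \<Longrightarrow> card C = r \<Longrightarrow> \<not> indep M C"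
  shows "H1 = H2"
proof -
  have "r \<le> card (H1 \<union> H2)"
    using hyperplaneD[OF assms(1)] hyperplaneD[OF assms(2)] card_mono[of "H1 \<union> H2" H1] by simp
  then have "uniformly_dependent M (H1 \<union> H2)"
    using hyperplaneD(1)[OF assms(1)] hyperplaneD(1)[OF assms(2)] assms(3)
    by (simp add: uniformly_dependent_iff)
  then have "H1 \<union> H2 = H1" "H1 \<union> H2 = H2"
    using assms(1,2) by (auto simp: dependent_hyperplanes_def)
  then show ?thesis by simp
qed

text \<open>Dependent hyperplanes that share \<open>r - 1\<close> points coincide: a basis in the union would augment these
  \<open>r - 1\<close> points to a basis inside one of the two.\<close>

lemma hyperplane_eq_if_large_inter:
  assumes H1: "H1 \<in> dependent_hyperplanes M" and H2: "H2 \<in> dependent_hyperplanes M"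
    and "r \<le> Suc (card (H1 \<inter> H2))"
  shows "H1 = H2"
proof (rule hyperplane_eq_if_union[OF H1 H2])
  fix B assume B: "B \<subseteq> H1 \<union> H2" "card B = r"
  obtain S where S: "S \<subseteq> H1 \<inter> H2" "card S = r - 1"
    using ex_subset_card assms(3) by blast
  have S_indep: "indep M S"
    using S hyperplaneD[OF H1] by (intro indep_if_card_less) auto
  have finS: "finite S"
    using S(1) hyperplaneD(4)[OF H1] finite_subset by blast
  show "\<not> indep M B"
  proof
    assume "indep M B"
    then obtain x where x: "x \<in> B - S" "indep M (insert x S)"
      using indep_augment[of B S] S_indep S(2) B(2) hyperplaneD(5)[OF H1] by auto
    have "card (insert x S) = r"
      using x(1) finS S(2) hyperplaneD(5)[OF H1] by simp
    moreover have "insert x S \<subseteq> H1 \<or> insert x S \<subseteq> H2"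
      using x(1) S(1) B(1) by auto
    ultimately show False
      using x(2) hyperplaneD(3)[OF H1] hyperplaneD(3)[OF H2] by blast
  qed
qed

lemma ex_hyperplane_of_circuit:
  assumes "C \<in> circuits M" "card C = r"
  shows "\<exists>H\<in>dependent_hyperplanes M. C \<subseteq> H"
proof (rule uniformly_dependent_extend)
  have "finite C" "C \<subseteq> ground M"
    using assms(1) finite_subset_ground by (auto simp: circuits_def)
  then have "D = C" if "D \<subseteq> C" "card D = r" for D
    using that assms(2) card_subset_eq by metis
  then show "uniformly_dependent M C"
    using assms \<open>C \<subseteq> ground M\<close> unfolding uniformly_dependent_def by auto
qed

lemma set_rank_hyperplane_subset:
  assumes "H \<in> dependent_hyperplanes M" "X \<subseteq> H" "r \<le> Suc (card X)"
  shows "set_rank M X = r - 1"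
proof -
  obtain S where S: "S \<subseteq> X" "card S = r - 1"
    using ex_subset_card assms(3) by blast
  have "indep M S"
    using S assms(2) hyperplaneD[OF assms(1)] by (intro indep_if_card_less) auto
  then have "r - 1 \<le> set_rank M X"
    using S card_le_set_rank by metis
  moreover have "set_rank M X < r"
    unfolding set_rank_less_iff
  proof (intro allI impI)
    fix Y assume Y: "Y \<subseteq> X" "indep M Y"
    then have "card Y \<noteq> r"
      using hyperplaneD(3)[OF assms(1), of Y] assms(2) by auto
    then show "card Y < r"
      using indep_card_le_rank[OF Y(2)] by simp
  qed
  ultimately show ?thesis by simp
qed

lemma closure_eq_hyperplane:
  assumes H: "H \<in> dependent_hyperplanes M" and C: "C \<subseteq> H" "card C = r"
  shows "matroid_closure M C = H"
proof -
  have finC: "finite C"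
    using C hyperplaneD(4)[OF H] finite_subset by blast
  have rC: "set_rank M C = r - 1"
    using set_rank_hyperplane_subset[OF H C(1)] C(2) by simp
  have "x \<in> H" if x: "x \<in> ground M" "set_rank M (insert x C) = r - 1" for x
  proof (cases "x \<in> C")
    case False
    obtain S where S: "S \<subseteq> C" "card S = r - 1"
      using ex_subset_card[of r C] C(2) by auto
    have card_S: "card (insert x S) = r"
      using S False finC finite_subset[OF S(1)] hyperplaneD(5)[OF H]
      by (subst card_insert_disjoint) auto
    have "\<not> indep M (insert x S)"
      using card_le_set_rank[of "insert x S" "insert x C"] insert_mono[OF S(1)] card_S x(2) hyperplaneD(5)[OF H] by auto
    then have "insert x S \<in> circuits M"
      using card_S x(1) S(1) C(1) hyperplaneD(1)[OF H] circuit_iff[of "insert x S"] by blast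
    then obtain H' where H': "H' \<in> dependent_hyperplanes M" "insert x S \<subseteq> H'"
      using ex_hyperplane_of_circuit card_S by blast
    have "card S \<le> card (H \<inter> H')"
      using S C H' hyperplaneD(4)[OF H] by (intro card_mono) auto
    then have "H = H'"
      using S(2) by (intro hyperplane_eq_if_large_inter[OF H H'(1)]) auto
    then show ?thesis using H'(2) by auto
  qed (use C in auto)
  moreover have "set_rank M (insert x C) = r - 1" if "x \<in> H" for x
    using that C finC card_insert_le[of C x] by (intro set_rank_hyperplane_subset[OF H]) auto
  ultimately show ?thesis
    using hyperplaneD(1)[OF H] by (auto simp: matroid_closure_def rC)
qed

lemma small_circuits_eq: "small_circuits M = {C \<in> circuits M. card C = r}"
  using circuit_card by (fastforce simp: small_circuits_def)

lemma matroid_subspaces_eq: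
  "matroid_subspaces M = (\<lambda>H. {C. C \<subseteq> H \<and> card C = r}) ` dependent_hyperplanes M"
proof -
  have circ: "C \<in> small_circuits M" if "H \<in> dependent_hyperplanes M" "C \<subseteq> H" "card C = r" for H C
    using hyperplaneD(1,3)[OF that(1)] that circuit_iff[of C] by (auto simp: small_circuits_eq)
  have cls: "same_closure M `` {C} = {D. D \<subseteq> H \<and> card D = r}"
    if H: "H \<in> dependent_hyperplanes M" "C \<subseteq> H" "card C = r" for H C
  proof -
    have "D \<subseteq> H" if "D \<in> small_circuits M" "matroid_closure M D = H" for D
      using that ex_hyperplane_of_circuit[of D] closure_eq_hyperplane by (auto simp: small_circuits_eq)
    then have "D \<subseteq> H \<and> card D = r \<longleftrightarrow> D \<in> small_circuits M \<and> matroid_closure M D = H" for D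
      using circ[OF H(1)] closure_eq_hyperplane[OF H(1)] by (auto simp: small_circuits_eq)
    moreover have "C \<in> small_circuits M" "matroid_closure M C = H"
      using circ[OF H] closure_eq_hyperplane[OF H] by blast+
    ultimately show ?thesis
      unfolding same_closure_def Image_singleton by (simp add: eq_commute[of H])
  qed
  show ?thesis
  proof (intro set_eqI iffI)
    fix l assume "l \<in> matroid_subspaces M"
    then obtain C where C: "C \<in> small_circuits M" "l = same_closure M `` {C}"
      by (auto simp: matroid_subspaces_def quotient_def)
    then obtain H where "H \<in> dependent_hyperplanes M" "C \<subseteq> H"
      using ex_hyperplane_of_circuit[of C] by (auto simp: small_circuits_eq)
    then show "l \<in> (\<lambda>H. {C. C \<subseteq> H \<and> card C = r}) ` dependent_hyperplanes M"
      using C cls[of H C] by (auto simp: small_circuits_eq)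
  next
    fix l assume "l \<in> (\<lambda>H. {C. C \<subseteq> H \<and> card C = r}) ` dependent_hyperplanes M"
    then obtain H where H: "H \<in> dependent_hyperplanes M" "l = {C. C \<subseteq> H \<and> card C = r}"
      by blast
    obtain C where C: "C \<subseteq> H" "card C = r"
      using obtain_subset_with_card_n[OF hyperplaneD(2)[OF H(1)]] by metis
    then show "l \<in> matroid_subspaces M"
      using cls[OF H(1) C] H(2) circ[OF H(1) C] by (auto simp: matroid_subspaces_def quotient_def)
  qed
qed

lemma Union_card_subsets:
  assumes "H \<in> dependent_hyperplanes M"
  shows "\<Union>{C. C \<subseteq> H \<and> card C = r} = H"
proof -
  have "\<exists>C. C \<subseteq> H \<and> card C = r \<and> p \<in> C" if "p \<in> H" for p
  proof -
    have "card (H - {p}) = card H - 1"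
      using that by simp
    then have "r \<le> Suc (card (H - {p}))"
      using hyperplaneD(2)[OF assms] by linarith
    then obtain S where S: "S \<subseteq> H - {p}" "card S = r - 1"
      using ex_subset_card by blast
    then have "card (insert p S) = r"
      using hyperplaneD(4,5)[OF assms] finite_subset[OF S(1)] by (subst card_insert_disjoint) auto
    then show ?thesis
      using that S(1) by (intro exI[of _ "insert p S"]) auto
  qed
  then show ?thesis by blast
qed

text \<open>\<open>\<Sum>rk(l) - r (k - 1) = k (r - 1) - r (k - 1) = r - k\<close> for a point \<open>p\<close> on \<open>k\<close> dependent hyperplanes.\<close>

lemma point_excess_eq:
  "point_excess M p = int r - int (card {H \<in> dependent_hyperplanes M. p \<in> H})"
proof -
  let ?f = "\<lambda>H. {C. C \<subseteq> H \<and> card C = r}"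
  let ?D = "{H \<in> dependent_hyperplanes M. p \<in> H}"
  have at: "subspaces_at M p = ?f ` ?D"
  proof -
    have "{l \<in> ?f ` dependent_hyperplanes M. P l} = ?f ` {H \<in> dependent_hyperplanes M. P (?f H)}" for P
      by blast
    moreover have "{H \<in> dependent_hyperplanes M. p \<in> \<Union>(?f H)} = ?D"
      by (intro Collect_cong conj_cong refl) (simp only: Union_card_subsets)
    ultimately show ?thesis
      unfolding subspaces_at_def matroid_subspaces_eq by simp
  qed
  have inj: "inj_on ?f ?D"
    by (rule inj_on_inverseI[of _ Union]) (simp only: mem_Collect_eq Union_card_subsets)
  have rk: "int (subspace_rank M l) = int r - 1" if "l \<in> subspaces_at M p" for l
  proof -
    obtain H where H: "H \<in> dependent_hyperplanes M" "l = ?f H"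
      using \<open>l \<in> subspaces_at M p\<close> at by blast
    obtain C where "C \<subseteq> H" "card C = r"
      using obtain_subset_with_card_n[OF hyperplaneD(2)[OF H(1)]] by metis
    then have C: "C \<in> l"
      using H(2) by simp
    have "set_rank M C' = r - 1" if "C' \<in> l" for C'
      using set_rank_hyperplane_subset[OF H(1), of C'] that H(2) by auto
    then have "subspace_rank M l = r - 1"
      unfolding subspace_rank_def using C by (intro the_equality) auto
    then show ?thesis
      using hyperplaneD(5)[OF H(1)] by simp
  qed
  have "(\<Sum>l\<in>subspaces_at M p. int (subspace_rank M l)) = int (card (subspaces_at M p)) * (int r - 1)"
    using rk by simp
  moreover have "card (subspaces_at M p) = card ?D"
    unfolding at by (rule card_image[OF inj])
  ultimately show ?thesis
    unfolding point_excess_def by (simp add: algebra_simps)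
qed


lemma subset_of_hyperplane_if_no_basis:
  assumes "N \<subseteq> ground M" "r \<le> card N" "\<And>C. C \<subseteq> N \<Longrightarrow> card C = r \<Longrightarrow> \<not> indep M C"
  shows "\<exists>H\<in>dependent_hyperplanes M. N \<subseteq> H"
  using uniformly_dependent_extend[of N] assms by (simp add: uniformly_dependent_iff)

lemma hyperplane_restriction:
  assumes N: "N \<subseteq> ground M" "matroid_rank (restriction M N) = r"
    and H: "H \<in> dependent_hyperplanes M" "r \<le> card (H \<inter> N)"
  shows "H \<inter> N \<in> dependent_hyperplanes (restriction M N)"
proof -
  have ground_N: "ground (restriction M N) = N"
    using N(1) by (auto simp: restriction_def)
  have ud: "uniformly_dependent (restriction M N) A \<longleftrightarrow> A \<subseteq> N \<and> uniformly_dependent M A" for A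
    unfolding uniformly_dependent_def ground_N N(2) circuits_restriction[OF N(1)] using N(1) by blast
  have "uniformly_dependent M (H \<inter> N)"
    using H hyperplaneD(1,3)[OF H(1)] unfolding uniformly_dependent_iff by blast
  moreover have "A = H \<inter> N" if A: "A \<subseteq> N" "uniformly_dependent M A" "H \<inter> N \<subseteq> A" for A
  proof -
    obtain H' where H': "H' \<in> dependent_hyperplanes M" "A \<subseteq> H'"
      using uniformly_dependent_extend[OF A(2)] by blast
    have "card (H \<inter> N) \<le> card (H \<inter> H')"
      using A(3) H'(2) hyperplaneD(4)[OF H(1)] by (intro card_mono) auto
    then have "H = H'"
      using H(2) by (intro hyperplane_eq_if_large_inter[OF H(1) H'(1)]) simp
    then show ?thesis
      using A H'(2) by blast
  qed
  ultimately show ?thesis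
    unfolding dependent_hyperplanes_def ud by blast
qed

text \<open>A point \<open>p\<close> that the solvable chain removes from \<open>N\<close> lies on fewer than \<open>r\<close> active hyperplanes, for
  any set \<open>X \<subseteq> N\<close> of points already present. If \<open>N\<close> has full rank, active hyperplanes of \<open>M\<close> restrict
  injectively to dependent hyperplanes of \<open>M|N\<close>; otherwise all of \<open>N\<close> lies in one hyperplane.\<close>

lemma card_active_hyperplanes:
  assumes N: "N \<subseteq> ground M" and p: "p \<in> N" "0 < point_excess (restriction M N) p"
    and X: "X \<subseteq> N" "p \<notin> X" and r: "2 < r"
  shows "card {H \<in> dependent_hyperplanes M. p \<in> H \<and> r \<le> Suc (card (H \<inter> X))} < r"
proof -
  let ?A = "{H \<in> dependent_hyperplanes M. p \<in> H \<and> r \<le> Suc (card (H \<inter> X))}"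
  have finN: "finite N"
    using N by (rule finite_subset_ground)
  have big: "r \<le> card (H \<inter> N)" if "H \<in> ?A" for H
  proof -
    have "finite (H \<inter> X)" "p \<notin> H \<inter> X"
      using X finN finite_subset by blast+
    then have "Suc (card (H \<inter> X)) = card (insert p (H \<inter> X))"
      by simp
    also have "\<dots> \<le> card (H \<inter> N)"
      using that X(1) p(1) finN by (intro card_mono) auto
    finally show ?thesis
      using that by simp
  qed
  interpret N: matroid "restriction M N"
    by (rule matroid_restriction)
  show ?thesis
  proof (cases "matroid_rank (restriction M N) = r")
    case True
    interpret N: paving_matroid "restriction M N"
      by unfold_locales (use paving True in \<open>auto simp: paving_def circuits_restriction[OF N]\<close>)
    have "card {H \<in> dependent_hyperplanes (restriction M N). p \<in> H} < r"
      using p(2) True by (simp add: N.point_excess_eq)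
    moreover have "card ?A \<le> card {H \<in> dependent_hyperplanes (restriction M N). p \<in> H}"
    proof (rule card_inj_on_le)
      show "inj_on (\<lambda>H. H \<inter> N) ?A"
      proof (rule inj_onI)
        fix H1 H2 assume H: "H1 \<in> ?A" "H2 \<in> ?A" "H1 \<inter> N = H2 \<inter> N"
        then have DH: "H1 \<in> dependent_hyperplanes M" "H2 \<in> dependent_hyperplanes M"
          by blast+
        have "card (H1 \<inter> N) \<le> card (H1 \<inter> H2)"
          using H(3) hyperplaneD(4)[OF DH(1)] by (intro card_mono) auto
        then show "H1 = H2"
          using big[OF H(1)] by (intro hyperplane_eq_if_large_inter[OF DH]) simp
      qed
      show "(\<lambda>H. H \<inter> N) ` ?A \<subseteq> {H \<in> dependent_hyperplanes (restriction M N). p \<in> H}"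
        using hyperplane_restriction[OF N True] big p(1) by blast
      show "finite {H \<in> dependent_hyperplanes (restriction M N). p \<in> H}"
        using N.finite_hyperplanes by simp
    qed
    ultimately show ?thesis by simp
  next
    case False
    show ?thesis
    proof (cases "?A = {}")
      case True
      show ?thesis unfolding True using r by simp
    next
      case nonempty: False
      have no_basis: "\<not> indep M C" if "C \<subseteq> N" "card C = r" for C
      proof
        assume "indep M C"
        then have "r \<le> matroid_rank (restriction M N)"
          using N.indep_card_le_rank[of C] that by (simp add: restriction_def)
        moreover obtain Y where "indep (restriction M N) Y" "card Y = matroid_rank (restriction M N)"
          using N.set_rank_attained unfolding matroid_rank_def by blast
        then have "matroid_rank (restriction M N) \<le> r"
          using indep_card_le_rank[of Y] by (simp add: restriction_def)
        ultimately show False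
          using False by simp
      qed
      obtain H where H: "H \<in> ?A"
        using nonempty by blast
      have "r \<le> card N"
        using big[OF H] card_mono[OF finN, of "H \<inter> N"] by simp
      then obtain H0 where H0: "H0 \<in> dependent_hyperplanes M" "N \<subseteq> H0"
        using subset_of_hyperplane_if_no_basis[OF N _ no_basis] by blast
      have "H = H0" if H: "H \<in> ?A" for H
      proof -
        have DH: "H \<in> dependent_hyperplanes M"
          using H by blast
        have "card (H \<inter> N) \<le> card (H \<inter> H0)"
          using H0(2) hyperplaneD(4)[OF DH] by (intro card_mono) auto
        then show ?thesis
          using big[OF H] by (intro hyperplane_eq_if_large_inter[OF DH H0(1)]) simp
      qed
      then have "?A \<subseteq> {H0}"
        by blast
      then have "card ?A \<le> 1"
        using card_mono[of "{H0}" ?A] by simp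
      then show ?thesis
        using r by simp
    qed
  qed
qed

end


section \<open>Building a matroid point by point\<close>

text \<open>The set is obtained from the empty set by adding points one at a time, so that at most two
  dependent hyperplanes are active at each new point \<open>p\<close>: those that contain \<open>p\<close> and at least \<open>r - 1\<close>
  of the earlier points.\<close>

inductive buildable :: "'a set_system \<Rightarrow> 'a set \<Rightarrow> bool" for M where
  empty: "buildable M {}"
| insert: "buildable M X \<Longrightarrow> p \<in> ground M \<Longrightarrow> p \<notin> X \<Longrightarrow>
    card {H \<in> dependent_hyperplanes M. p \<in> H \<and> matroid_rank M \<le> Suc (card (H \<inter> X))} \<le> 2 \<Longrightarrow>
    buildable M (insert p X)"

lemma buildable_Un:
  assumes "finite D" "buildable M X" "D \<subseteq> ground M" "X \<inter> D = {}"
    and "\<And>Y p. X \<subseteq> Y \<Longrightarrow> Y \<subseteq> X \<union> D \<Longrightarrow> p \<in> D - Y \<Longrightarrow>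
      card {H \<in> dependent_hyperplanes M. p \<in> H \<and> matroid_rank M \<le> Suc (card (H \<inter> Y))} \<le> 2"
  shows "buildable M (X \<union> D)"
proof -
  have "E \<subseteq> D \<Longrightarrow> buildable M (X \<union> E)" if "finite E" for E
    using that
  proof (induction E rule: finite_induct)
    case (insert p E)
    have "buildable M (insert p (X \<union> E))"
    proof (rule buildable.insert)
      show "p \<notin> X \<union> E"
        using insert assms(4) by blast
      show "card {H \<in> dependent_hyperplanes M. p \<in> H \<and> matroid_rank M \<le> Suc (card (H \<inter> (X \<union> E)))} \<le> 2"
        using insert assms(4) by (intro assms(5)) auto
    qed (use insert assms(3) in auto)
    then show ?case by simp
  qed (use assms(2) in simp)
  then show ?thesis
    using assms(1) by blast
qed

lemma (in matroid) solvable_chain_eq_restriction: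
  "solvable_chain M j = restriction M (ground (solvable_chain M j))"
  "ground (solvable_chain M j) \<subseteq> ground M"
proof -
  have idem: "restriction M N = restriction M (ground (restriction M N))" for N
    using indep_subset_ground by (auto simp: restriction_def fun_eq_iff)
  have self: "M = restriction M (ground M)"
    using indep_subset_ground by (cases M) (auto simp: restriction_def fun_eq_iff)
  show "solvable_chain M j = restriction M (ground (solvable_chain M j))"
    by (cases j) (simp_all only: solvable_chain.simps self[symmetric] idem[symmetric])
  show "ground (solvable_chain M j) \<subseteq> ground M"
    by (cases j) (auto simp: restriction_def)
qed

context paving_matroid
begin

text \<open>The chain is run backwards: each step adds the points of one layer, in any order.\<close>

lemma buildable_if_solvable:
  assumes "r = 3" "solvable M"
  shows "buildable M (ground M)"
proof -
  obtain j where "ground (solvable_chain M j) = {}"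
    using assms(2) by (auto simp: solvable_def)
  then have "buildable M (ground (solvable_chain M j))"
    by (simp add: buildable.empty)
  then have "buildable M (ground (solvable_chain M 0))"
  proof (induction j)
    case (Suc j)
    define N where "N = ground (solvable_chain M j)"
    define Q where "Q = ground (solvable_chain M (Suc j))"
    have chain: "solvable_chain M j = restriction M N" and N: "N \<subseteq> ground M"
      unfolding N_def by (rule solvable_chain_eq_restriction)+
    have ground_N: "ground (restriction M N) = N"
      using N by (auto simp: restriction_def)
    have Q: "Q = {p \<in> N. point_excess (restriction M N) p \<le> 0}"
      using N unfolding Q_def solvable_chain.simps chain Q_set_def ground_N
      by (auto simp: restriction_def)
    have "buildable M (Q \<union> (N - Q))"
    proof (rule buildable_Un)
      show "finite (N - Q)"
        using finite_subset_ground[OF N] by simp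
      show "buildable M Q"
        using Suc.prems by (simp only: Q_def)
    next
      fix Y p assume Y: "Q \<subseteq> Y" "Y \<subseteq> Q \<union> (N - Q)" "p \<in> (N - Q) - Y"
      then have "p \<in> N" "0 < point_excess (restriction M N) p" "Y \<subseteq> N" "p \<notin> Y"
        unfolding Q by auto
      then show "card {H \<in> dependent_hyperplanes M. p \<in> H \<and> r \<le> Suc (card (H \<inter> Y))} \<le> 2"
        using card_active_hyperplanes[OF N, of p Y] assms(1) by simp
    qed (use N in auto)
    moreover have "Q \<union> (N - Q) = N"
      unfolding Q by blast
    ultimately have "buildable M N"
      by simp
    then show ?case
      unfolding N_def by (rule Suc.IH)
  qed simp
  then show ?thesis by simp
qed

lemma buildable_if_few_hyperplanes:
  assumes "\<And>p. p \<in> ground M \<Longrightarrow> card {H \<in> dependent_hyperplanes M. p \<in> H} \<le> 2"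
  shows "buildable M (ground M)"
proof -
  have "buildable M ({} \<union> ground M)"
  proof (rule buildable_Un)
    fix Y p assume "p \<in> ground M - Y"
    moreover have "card {H \<in> dependent_hyperplanes M. p \<in> H \<and> r \<le> Suc (card (H \<inter> Y))}
        \<le> card {H \<in> dependent_hyperplanes M. p \<in> H}"
      using finite_hyperplanes by (intro card_mono) auto
    ultimately show "card {H \<in> dependent_hyperplanes M. p \<in> H \<and> r \<le> Suc (card (H \<inter> Y))} \<le> 2"
      using assms[of p] by simp
  qed (use finite_ground buildable.empty in auto)
  then show ?thesis by simp
qed

text \<open>In rank two, dependent hyperplanes are disjoint; in rank one, they consist of loops. So the bound
  by two suffices for every rank.\<close>

lemma card_hyperplanes_at_less_rank:
  assumes "loopless M" "p \<in> ground M" "card {H \<in> dependent_hyperplanes M. p \<in> H} \<le> 2"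
  shows "card {H \<in> dependent_hyperplanes M. p \<in> H} < r"
proof -
  have p: "indep M {p}"
    using assms(1,2) by (auto simp: loopless_def)
  have "1 \<le> r"
    using indep_card_le_rank[OF p] by simp
  then consider "r = 1" | "r = 2" | "2 < r"
    by linarith
  then show ?thesis
  proof cases
    case 1
    have none: "{H \<in> dependent_hyperplanes M. p \<in> H} = {}"
      using hyperplaneD(3)[of _ "{p}"] 1 p by auto
    show ?thesis unfolding none using 1 by simp
  next
    case 2
    have eq: "H1 = H2" if "H1 \<in> {H \<in> dependent_hyperplanes M. p \<in> H}" "H2 \<in> {H \<in> dependent_hyperplanes M. p \<in> H}"
      for H1 H2
    proof -
      have DH: "H1 \<in> dependent_hyperplanes M" "H2 \<in> dependent_hyperplanes M"
        using that by blast+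
      have "card {p} \<le> card (H1 \<inter> H2)"
        using that hyperplaneD(4)[OF DH(1)] by (intro card_mono) auto
      then show ?thesis
        using 2 by (intro hyperplane_eq_if_large_inter[OF DH]) simp
    qed
    have "card {H \<in> dependent_hyperplanes M. p \<in> H} \<le> Suc 0"
      using eq finite_hyperplanes by (subst card_le_Suc0_iff_eq) auto
    then show ?thesis using 2 by simp
  qed (use assms(3) in simp)
qed

lemma solvable_if_few_hyperplanes:
  assumes "loopless M" "\<And>p. p \<in> ground M \<Longrightarrow> card {H \<in> dependent_hyperplanes M. p \<in> H} \<le> 2"
  shows "solvable M"
proof -
  have "0 < point_excess M p" if "p \<in> ground M" for p
    using card_hyperplanes_at_less_rank[OF assms(1) that assms(2)[OF that]] by (simp add: point_excess_eq)
  then have "Q_set M = {}"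
    by (force simp: Q_set_def)
  then show ?thesis
    unfolding solvable_def by (intro exI[of _ 1]) (simp add: restriction_def)
qed


section \<open>Curves in the realization space\<close>

text \<open>The vectors \<open>v p\<close> represent the matroid: condition defining the realization space, for families that
  are curried and not restricted to the ground set.\<close>

definition realizes :: "('a \<Rightarrow> nat \<Rightarrow> complex) \<Rightarrow> bool" where
  "realizes v \<longleftrightarrow> (\<forall>A\<subseteq>ground M. lin_dep {1..r} v A \<longleftrightarrow> \<not> indep M A)"

lemma realizesD: "realizes v \<Longrightarrow> A \<subseteq> ground M \<Longrightarrow> lin_dep {1..r} v A \<longleftrightarrow> \<not> indep M A"
  by (simp add: realizes_def)

text \<open>A nonzero linear form that vanishes on the vectors of all points of \<open>H\<close>.\<close>

definition is_normal :: "('a \<Rightarrow> nat \<Rightarrow> complex) \<Rightarrow> 'a set \<Rightarrow> (nat \<Rightarrow> complex) \<Rightarrow> bool" where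
  "is_normal v H n \<longleftrightarrow> (\<exists>k\<in>{1..r}. n k \<noteq> 0) \<and> (\<forall>q\<in>H. dot {1..r} n (v q) = 0)"

lemma ex_normal:
  assumes v: "realizes v" and H: "H \<in> dependent_hyperplanes M"
  shows "\<exists>n. is_normal v H n"
proof -
  obtain S where S: "S \<subseteq> H" "card S = r - 1"
    using ex_subset_card[of r H] hyperplaneD(2)[OF H] by auto
  have finS: "finite S" and S_ground: "S \<subseteq> ground M"
    using S(1) hyperplaneD(1,4)[OF H] finite_subset by blast+
  have card_S: "card S < card {1..r}"
    using S(2) hyperplaneD(5)[OF H] by simp
  have indep: "\<not> lin_dep {1..r} v S"
    using v S_ground indep_if_card_less[OF S_ground] card_S by (auto simp: realizes_def)
  obtain n where n: "\<exists>k\<in>{1..r}. n k \<noteq> 0" "\<And>i. i \<in> S \<Longrightarrow> dot {1..r} n (v i) = 0"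
    using ex_common_normal[OF _ finS card_S] by blast
  have "dot {1..r} n (v q) = 0" if "q \<in> H" for q
  proof (cases "q \<in> S")
    case False
    have "card (insert q S) = r"
      using False finS S(2) hyperplaneD(5)[OF H] by simp
    then have "\<not> indep M (insert q S)"
      using S(1) that by (intro hyperplaneD(3)[OF H]) auto
    then have "lin_dep {1..r} v (insert q S)"
      using v S_ground that hyperplaneD(1)[OF H] unfolding realizes_def by blast
    then show ?thesis
      using normal_insert[OF finS False indep] n(2) by blast
  qed (use n(2) in blast)
  then show ?thesis
    using n(1) unfolding is_normal_def by blast
qed

text \<open>Two parallel normals would put all vectors of two dependent hyperplanes into one linear hyperplane,
  and then their union would be uniformly dependent.\<close>

lemma normals_independent:
  assumes v: "realizes v" and A: "A \<subseteq> dependent_hyperplanes M" "card A \<le> 2"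
    and n: "\<And>H. H \<in> A \<Longrightarrow> is_normal v H (n H)"
  shows "\<not> lin_dep {1..r} n A"
proof
  assume "lin_dep {1..r} n A"
  then obtain c H where H: "H \<in> A" "c H \<noteq> 0"
    and c: "\<And>k. k \<in> {1..r} \<Longrightarrow> (\<Sum>H\<in>A. c H * n H k) = 0"
    unfolding lin_dep_def by blast
  have finA: "finite A"
    using A(1) finite_hyperplanes finite_subset by blast
  obtain m where m: "m \<in> {1..r}" "n H m \<noteq> 0"
    using n[OF H(1)] unfolding is_normal_def by blast
  have "A - {H} \<noteq> {}"
  proof
    assume "A - {H} = {}"
    then have "A = {H}"
      using H(1) by blast
    then show False
      using c[OF m(1)] m(2) H(2) by simp
  qed
  then obtain H' where H': "H' \<in> A" "H' \<noteq> H"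
    by blast
  have "card {H, H'} = 2"
    using H'(2) by simp
  then have A_eq: "A = {H, H'}"
    using H(1) H'(1) A(2) finA by (intro sym[OF card_seteq]) auto
  have eq: "n H k = - (c H' / c H) * n H' k" if "k \<in> {1..r}" for k
    using c[OF that] H(2) H'(2) unfolding A_eq by (simp add: field_simps add_eq_0_iff)
  have dot_eq: "dot {1..r} (n H) x = - (c H' / c H) * dot {1..r} (n H') x" for x
    unfolding dot_def sum_distrib_left using eq by (intro sum.cong) (simp_all add: mult.assoc)
  have normal: "dot {1..r} (n H) (v q) = 0" if "q \<in> H \<union> H'" for q
    using that n[OF H(1)] n[OF H'(1)] dot_eq[of "v q"] unfolding is_normal_def by auto
  have DH: "H \<in> dependent_hyperplanes M" "H' \<in> dependent_hyperplanes M"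
    using H(1) H'(1) A(1) by blast+
  have "\<not> indep M C" if C: "C \<subseteq> H \<union> H'" "card C = r" for C
  proof -
    have "C \<subseteq> ground M"
      using C(1) hyperplaneD(1)[OF DH(1)] hyperplaneD(1)[OF DH(2)] by blast
    moreover have "lin_dep {1..r} v C"
      using C normal finite_subset_ground[OF \<open>C \<subseteq> ground M\<close>] m
      by (intro lin_dep_if_common_normal[where n = "n H" and m = m]) auto
    ultimately show ?thesis
      using v by (simp add: realizes_def)
  qed
  then have "H = H'"
    by (rule hyperplane_eq_if_union[OF DH])
  then show False
    using H'(2) by simp
qed

text \<open>The end points \<open>n0 H\<close>, \<open>n1 H\<close> of the curves of normals are fixed in advance, but the curve of
  normals of \<open>H\<close> exists only once \<open>r - 1\<close> points of \<open>H\<close> are present; from then on it never changes and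
  constrains all further points of \<open>H\<close>.\<close>

lemma ex_curve:
  assumes "buildable M X" and v0: "realizes v0" and v1: "realizes v1"
    and n0: "\<And>H. H \<in> dependent_hyperplanes M \<Longrightarrow> is_normal v0 H (n0 H)"
    and n1: "\<And>H. H \<in> dependent_hyperplanes M \<Longrightarrow> is_normal v1 H (n1 H)"
  shows "\<exists>v. (\<forall>p k. (\<lambda>s. v s p k) \<in> range poly) \<and> v 0 = v0 \<and> v 1 = v1 \<and>
    (\<forall>H\<in>dependent_hyperplanes M. r \<le> Suc (card (H \<inter> X)) \<longrightarrow>
      (\<exists>n. (\<forall>k. (\<lambda>s. n s k) \<in> range poly) \<and> n 0 = n0 H \<and> n 1 = n1 H \<and>
        (\<forall>s. \<forall>q\<in>H \<inter> X. dot {1..r} (n s) (v s q) = 0)))"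
  using assms(1)
proof (induction rule: buildable.induct)
  case empty
  show ?case
    by (rule exI[of _ "\<lambda>s p k. (1 - s) * v0 p k + s * v1 p k"])
      (auto intro!: poly_fun_intros exI[of _ "\<lambda>s k. (1 - s) * n0 _ k + s * n1 _ k"])
next
  case (insert X p)
  let ?DH = "dependent_hyperplanes M"
  obtain v where v: "\<And>p k. (\<lambda>s. v s p k) \<in> range poly" "v 0 = v0" "v 1 = v1"
    and ex_n: "\<forall>H\<in>?DH. r \<le> Suc (card (H \<inter> X)) \<longrightarrow>
      (\<exists>n. (\<forall>k. (\<lambda>s. n s k) \<in> range poly) \<and> n 0 = n0 H \<and> n 1 = n1 H \<and>
        (\<forall>s. \<forall>q\<in>H \<inter> X. dot {1..r} (n s) (v s q) = 0))"
    using insert.IH by blast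
  obtain n where n_all: "\<forall>H\<in>?DH. r \<le> Suc (card (H \<inter> X)) \<longrightarrow>
      (\<forall>k. (\<lambda>s. n H s k) \<in> range poly) \<and> n H 0 = n0 H \<and> n H 1 = n1 H \<and>
        (\<forall>s. \<forall>q\<in>H \<inter> X. dot {1..r} (n H s) (v s q) = 0)"
    using ex_n by metis
  define A where "A = {H \<in> ?DH. p \<in> H \<and> r \<le> Suc (card (H \<inter> X))}"
  have A: "A \<subseteq> ?DH" "finite A" "card A \<le> 2"
    using finite_hyperplanes insert.hyps by (auto simp: A_def)
  have n_A: "(\<lambda>s. n H s k) \<in> range poly" "n H 0 = n0 H" "n H 1 = n1 H" if "H \<in> A" for H k
    using n_all that by (auto simp: A_def)
  \<comment> \<open>the new point moves inside the intersection of the active hyperplanes\<close>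
  have ex_x: "\<exists>x. (\<forall>k. (\<lambda>s. x s k) \<in> range poly) \<and> x 0 = v0 p \<and> x 1 = v1 p \<and>
    (\<forall>s. \<forall>H\<in>A. dot {1..r} (n H s) (x s) = 0)"
  proof (rule kernel_curve[where v = "\<lambda>s H. n H s"])
    show "\<not> lin_dep {1..r} (\<lambda>H. n H 0) A"
      using n_A n0 A(1) by (intro normals_independent[OF v0 A(1,3)]) auto
    show "\<not> lin_dep {1..r} (\<lambda>H. n H 1) A"
      using n_A n1 A(1) by (intro normals_independent[OF v1 A(1,3)]) auto
    show "dot {1..r} (n H 0) (v0 p) = 0" if "H \<in> A" for H
      using that n_A(2) n0 by (auto simp: is_normal_def A_def)
    show "dot {1..r} (n H 1) (v1 p) = 0" if "H \<in> A" for H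
      using that n_A(3) n1 by (auto simp: is_normal_def A_def)
  qed (use n_A A in auto)
  then obtain x where x: "\<And>k. (\<lambda>s. x s k) \<in> range poly" "x 0 = v0 p" "x 1 = v1 p"
    "\<And>s H. H \<in> A \<Longrightarrow> dot {1..r} (n H s) (x s) = 0"
    by blast
  define w where "w = (\<lambda>s. (v s)(p := x s))"
  have w: "(\<lambda>s. w s q k) \<in> range poly" for q k
    using v(1) x(1) by (cases "q = p") (auto simp: w_def)
  have w_ends: "w 0 = v0" "w 1 = v1"
    using v(2,3) x(2,3) by (auto simp: w_def)
  have "\<exists>m. (\<forall>k. (\<lambda>s. m s k) \<in> range poly) \<and> m 0 = n0 H \<and> m 1 = n1 H \<and>
      (\<forall>s. \<forall>q\<in>H \<inter> insert p X. dot {1..r} (m s) (w s q) = 0)"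
    if H: "H \<in> ?DH" "r \<le> Suc (card (H \<inter> insert p X))" for H
  proof (cases "r \<le> Suc (card (H \<inter> X))")
    case True
    have "dot {1..r} (n H s) (w s q) = 0" if "q \<in> H \<inter> insert p X" for s q
    proof (cases "q = p")
      case eq: True
      then have "H \<in> A"
        using that H(1) True by (simp add: A_def)
      then show ?thesis
        using x(4) eq by (simp add: w_def)
    next
      case False
      then show ?thesis
        using n_all H(1) True that by (simp add: w_def)
    qed
    then show ?thesis
      using n_all H(1) True by (intro exI[of _ "n H"]) blast
  next
    case False
    \<comment> \<open>with \<open>p\<close>, the hyperplane \<open>H\<close> now has exactly \<open>r - 1\<close> points: its curve of normals is created\<close>
    have fin: "finite (H \<inter> X)"
      using hyperplaneD(4)[OF H(1)] by simp
    have "p \<in> H"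
      using H(2) False by (cases "p \<in> H") auto
    then have "card (H \<inter> insert p X) = Suc (card (H \<inter> X))"
      using fin insert.hyps by simp
    moreover have sub: "H \<inter> insert p X \<subseteq> ground M"
      using hyperplaneD(1)[OF H(1)] by blast
    ultimately have "indep M (H \<inter> insert p X)"
      using False by (intro indep_if_card_less) auto
    then have indep: "\<not> lin_dep {1..r} v0 (H \<inter> insert p X)" "\<not> lin_dep {1..r} v1 (H \<inter> insert p X)"
      using realizesD[OF v0 sub] realizesD[OF v1 sub] by blast+
    have "\<exists>m. (\<forall>k. (\<lambda>s. m s k) \<in> range poly) \<and> m 0 = n0 H \<and> m 1 = n1 H \<and>
      (\<forall>s. \<forall>q\<in>H \<inter> insert p X. dot {1..r} (w s q) (m s) = 0)"
      using indep w w_ends n0[OF H(1)] n1[OF H(1)] hyperplaneD(4)[OF H(1)]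
      by (intro kernel_curve) (auto simp: is_normal_def dot_commute[of _ "v0 _"] dot_commute[of _ "v1 _"])
    then show ?thesis
      by (simp only: dot_commute)
  qed
  then show ?case
    using w w_ends by (intro exI[of _ w]) blast
qed

text \<open>The required dependencies need no separate control along a curve: circuits of size \<open>r + 1\<close> are
  dependent for dimension reasons, and those of size \<open>r\<close> because their hyperplane has a normal.\<close>

lemma dependent_if_normals:
  assumes "\<And>H. H \<in> dependent_hyperplanes M \<Longrightarrow> \<exists>n. is_normal v H n"
    and A: "A \<subseteq> ground M" "\<not> indep M A"
  shows "lin_dep {1..r} v A"
proof -
  obtain C where C: "C \<in> circuits M" "C \<subseteq> A"
    using ex_circuit_subset[OF A] by blast
  have finA: "finite A" and finC: "finite C"
    using A(1) C(2) finite_subset_ground by blast+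
  have "lin_dep {1..r} v C"
  proof (cases "card C = r")
    case True
    obtain H where H: "H \<in> dependent_hyperplanes M" "C \<subseteq> H"
      using ex_hyperplane_of_circuit[OF C(1) True] by blast
    obtain n m where n: "m \<in> {1..r}" "n m \<noteq> 0" "\<And>q. q \<in> H \<Longrightarrow> dot {1..r} n (v q) = 0"
      using assms(1)[OF H(1)] unfolding is_normal_def by blast
    show ?thesis
      using True finC n H(2) by (intro lin_dep_if_common_normal[where n = n and m = m]) auto
  next
    case False
    then have "r < card C"
      using circuit_card[OF C(1)] by simp
    then show ?thesis
      using finC by (intro lin_dep_if_card_less) auto
  qed
  then show ?thesis
    using C(2) finA by (rule lin_dep_mono)
qed

lemma mem_realization_space_iff:
  "\<gamma> \<in> realization_space M \<longleftrightarrow> \<gamma> \<in> affine_space (coordinate_indices M) \<and> realizes (curry \<gamma>)"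
  by (simp add: realization_space_def realizes_def dependent_subfamily_iff_lin_dep)

lemma realizes_restrict:
  "realizes (curry (restrict (case_prod v) (coordinate_indices M))) \<longleftrightarrow> realizes v"
proof -
  have "lin_dep {1..r} (curry (restrict (case_prod v) (coordinate_indices M))) A = lin_dep {1..r} v A"
    if "A \<subseteq> ground M" for A
  proof -
    have eq: "(\<Sum>i\<in>A. c i * curry (restrict (case_prod v) (coordinate_indices M)) i k) = (\<Sum>i\<in>A. c i * v i k)"
      if "k \<in> {1..r}" for c k
      using that \<open>A \<subseteq> ground M\<close> by (intro sum.cong) (auto simp: coordinate_indices_def)
    show ?thesis
      unfolding lin_dep_def by (intro ex_cong1 conj_cong refl ball_cong) (simp only: eq)
  qed
  then show ?thesis
    by (simp add: realizes_def)
qed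

lemma irreducible_if_buildable:
  assumes "buildable M (ground M)"
  shows "zariski_irreducible (coordinate_indices M) (realization_space M)"
proof (rule zariski_irreducible_if_curves)
  let ?I = "coordinate_indices M" and ?DH = "dependent_hyperplanes M"
  show "realization_space M \<subseteq> affine_space ?I"
    by (auto simp: realization_space_def)
  fix x y assume x: "x \<in> realization_space M" and y: "y \<in> realization_space M"
  define v0 v1 where "v0 = curry x" and "v1 = curry y"
  have v0: "realizes v0" and v1: "realizes v1"
    using x y by (auto simp: mem_realization_space_iff v0_def v1_def)
  obtain n0 where n0: "\<And>H. H \<in> ?DH \<Longrightarrow> is_normal v0 H (n0 H)"
    using ex_normal[OF v0] by metis
  obtain n1 where n1: "\<And>H. H \<in> ?DH \<Longrightarrow> is_normal v1 H (n1 H)"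
    using ex_normal[OF v1] by metis
  obtain v where v: "\<And>p k. (\<lambda>s. v s p k) \<in> range poly" "v 0 = v0" "v 1 = v1"
    and ex_n: "\<forall>H\<in>?DH. r \<le> Suc (card (H \<inter> ground M)) \<longrightarrow>
      (\<exists>n. (\<forall>k. (\<lambda>s. n s k) \<in> range poly) \<and> n 0 = n0 H \<and> n 1 = n1 H \<and>
        (\<forall>s. \<forall>q\<in>H \<inter> ground M. dot {1..r} (n s) (v s q) = 0))"
    using ex_curve[OF assms v0 v1 n0 n1] by blast
  have normal: "\<exists>n m. m \<in> {1..r} \<and> (\<lambda>s. n s m) \<in> range poly \<and> n 0 m \<noteq> 0 \<and>
    (\<forall>s. \<forall>q\<in>H. dot {1..r} (n s) (v s q) = 0)" if H: "H \<in> ?DH" for H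
  proof -
    have "H \<inter> ground M = H" "r \<le> Suc (card H)"
      using hyperplaneD(1,2)[OF H] by auto
    then obtain n where n: "\<forall>k. (\<lambda>s. n s k) \<in> range poly" "n 0 = n0 H"
        "\<forall>s. \<forall>q\<in>H. dot {1..r} (n s) (v s q) = 0"
      using ex_n H by metis
    obtain m where "m \<in> {1..r}" "n 0 m \<noteq> 0"
      using n0[OF H] n(2) unfolding is_normal_def by auto
    then show ?thesis
      using n by blast
  qed
  obtain n m where nm: "\<And>H. H \<in> ?DH \<Longrightarrow> m H \<in> {1..r}"
    "\<And>H. H \<in> ?DH \<Longrightarrow> (\<lambda>s. n H s (m H)) \<in> range poly"
    "\<And>H. H \<in> ?DH \<Longrightarrow> n H 0 (m H) \<noteq> 0"
    "\<And>H s q. H \<in> ?DH \<Longrightarrow> q \<in> H \<Longrightarrow> dot {1..r} (n H s) (v s q) = 0"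
    using normal by metis
  \<comment> \<open>parameters where an independent set degenerates or a normal might vanish\<close>
  define bad where "bad = (\<Union>A\<in>{A. indep M A}. {s. lin_dep {1..r} (v s) A}) \<union>
    (\<Union>H\<in>?DH. {s. n H s (m H) = 0})"
  have "finite bad"
    unfolding bad_def
  proof (intro finite_UnI finite_UN_I)
    show "finite {A. indep M A}"
      by (rule finite_subset[of _ "Pow (ground M)"]) (use finite_ground indep_subset_ground in auto)
    show "finite {s. lin_dep {1..r} (v s) A}" if "A \<in> {A. indep M A}" for A
    proof (rule finite_lin_dep_curve)
      show "finite A"
        using that indep_subset_ground finite_subset_ground by simp
      show "\<not> lin_dep {1..r} (v 0) A"
        using that v0 v(2) indep_subset_ground by (simp add: realizes_def)
    qed (rule v(1))
    show "finite ?DH"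
      by (rule finite_hyperplanes)
    show "finite {s. n H s (m H) = 0}" if "H \<in> ?DH" for H
      using nm(2,3)[OF that] by (rule finite_zeros_poly_fun)
  qed
  have good: "realizes (v s)" if "s \<notin> bad" for s
  proof -
    have "\<exists>n. is_normal (v s) H n" if H: "H \<in> ?DH" for H
    proof -
      have "n H s (m H) \<noteq> 0"
        using H \<open>s \<notin> bad\<close> by (auto simp: bad_def)
      then show ?thesis
        using nm(1,4)[OF H] unfolding is_normal_def by blast
    qed
    then have "lin_dep {1..r} (v s) A" if "A \<subseteq> ground M" "\<not> indep M A" for A
      using that by (rule dependent_if_normals)
    moreover have "\<not> lin_dep {1..r} (v s) A" if "indep M A" for A
      using that \<open>s \<notin> bad\<close> by (auto simp: bad_def)
    ultimately show ?thesis
      unfolding realizes_def by blast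
  qed
  define c where "c = (\<lambda>s. restrict (case_prod (v s)) ?I)"
  have "c s \<in> realization_space M \<longleftrightarrow> realizes (v s)" for s
    unfolding mem_realization_space_iff c_def realizes_restrict by (simp add: affine_space_def)
  then have "{s. c s \<notin> realization_space M} \<subseteq> bad"
    using good by blast
  then have "finite {s. c s \<notin> realization_space M}"
    using \<open>finite bad\<close> finite_subset by blast
  moreover have "restrict (case_prod (curry z)) ?I = z" if "z \<in> realization_space M" for z
  proof -
    have "z \<in> ?I \<rightarrow>\<^sub>E UNIV"
      using that by (simp add: realization_space_def affine_space_def)
    then show ?thesis
      unfolding case_prod_curry by (rule PiE_restrict)
  qed
  then have "c 0 = x" "c 1 = y"
    using x y by (simp_all add: c_def v v0_def v1_def)
  moreover have "(\<lambda>s. c s i) \<in> range poly" if "i \<in> ?I" for i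
    using that v(1) by (cases i) (simp add: c_def)
  ultimately show "\<exists>c. (\<forall>i\<in>?I. (\<lambda>s. c s i) \<in> range poly) \<and> c 0 = x \<and> c 1 = y \<and>
      finite {s. c s \<notin> realization_space M}"
    by blast
qed

end

lemma (in matroid) paving_if_simple_rank_three:
  assumes "matroid_rank M = 3" "simple_matroid M"
  shows "paving M"
  unfolding paving_def
proof
  fix C assume "C \<in> circuits M"
  then have "2 < card C" "card C \<le> matroid_rank M + 1"
    using assms(2) card_circuit_le by (auto simp: simple_matroid_def)
  then show "card C = matroid_rank M \<or> card C = matroid_rank M + 1"
    using assms(1) by linarith
qed

lemma card_le_two_if_no_triple:
  assumes "\<And>x y z. x \<in> S \<Longrightarrow> y \<in> S \<Longrightarrow> z \<in> S \<Longrightarrow> x \<noteq> y \<Longrightarrow> x \<noteq> z \<Longrightarrow> y \<noteq> z \<Longrightarrow> False"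
  shows "card S \<le> 2"
proof (rule ccontr)
  assume "\<not> card S \<le> 2"
  then have "3 \<le> card S"
    by simp
  then obtain T where T: "T \<subseteq> S" "card T = 3"
    using obtain_subset_with_card_n by metis
  then obtain x y z where "T = {x, y, z}" "x \<noteq> y" "y \<noteq> z" "x \<noteq> z"
    by (auto simp: card_3_iff)
  then show False
    using assms[of x y z] T(1) by auto
qed

theorem theorem1:
  fixes n :: nat and M :: "nat set_system"
  assumes "matroid M" and "ground M = {1..n}"
  shows "(matroid_rank M = 3 \<and> simple_matroid M \<and> solvable M \<longrightarrow>
            zariski_irreducible (coordinate_indices M) (realization_space M)) \<and>
         (paving M \<and>
          (\<forall>H1\<in>dependent_hyperplanes M. \<forall>H2\<in>dependent_hyperplanes M. \<forall>H3\<in>dependent_hyperplanes M.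
             H1 \<noteq> H2 \<and> H1 \<noteq> H3 \<and> H2 \<noteq> H3 \<longrightarrow> H1 \<inter> H2 \<inter> H3 = {}) \<longrightarrow>
            (loopless M \<longrightarrow> solvable M) \<and>
            zariski_irreducible (coordinate_indices M) (realization_space M))"
proof (intro conjI impI; elim conjE)
  interpret matroid M
    by (rule assms(1))
  {
    assume a: "matroid_rank M = 3" "simple_matroid M" "solvable M"
    interpret paving_matroid M
      by unfold_locales (rule paving_if_simple_rank_three[OF a(1,2)])
    show "zariski_irreducible (coordinate_indices M) (realization_space M)"
      using buildable_if_solvable[OF a(1,3)] by (rule irreducible_if_buildable)
  next
    assume paving: "paving M"
      and triple: "\<forall>H1\<in>dependent_hyperplanes M. \<forall>H2\<in>dependent_hyperplanes M. \<forall>H3\<in>dependent_hyperplanes M.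
             H1 \<noteq> H2 \<and> H1 \<noteq> H3 \<and> H2 \<noteq> H3 \<longrightarrow> H1 \<inter> H2 \<inter> H3 = {}"
    interpret paving_matroid M
      by unfold_locales (rule paving)
    have few: "card {H \<in> dependent_hyperplanes M. p \<in> H} \<le> 2" for p
      using triple by (intro card_le_two_if_no_triple) blast
    show "zariski_irreducible (coordinate_indices M) (realization_space M)"
      using few by (intro irreducible_if_buildable buildable_if_few_hyperplanes)
    show "solvable M" if "loopless M"
      using that few by (rule solvable_if_few_hyperplanes)
  }
qed

end
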